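(* Let $\mathcal{U}$ be a $\kappa$-universal domain for $APA$ ($\kappa$ uncountable), let $C\subseteq U$ be small, and let $a=(a_1,\dots,a_n)$ and $b=(b_1,\dots,b_n)$ be partitions of $1$ in $\mathcal{U}$. Then $$d(\mathrm{tp}(a/C),\mathrm{tp}(b/C))=\max_{1\le i\le n}\|\mathbb{P}(a_i\mid\langle C\rangle)-\mathbb{P}(b_i\mid\langle C\rangle)\|_1.$$ Moreover, there exists a partition of $1$, $b'=(b'_1,\dots,b'_n)$, in $\mathcal{U}$ such that $\mathrm{tp}(b'/C)=\mathrm{tp}(b/C)$ and $d(a_i,b'_i)=\|\mathbb{P}(a_i\mid\langle C\rangle)-\mathbb{P}(b_i\mid\langle C\rangle)\|_1$ for all $i=1,\dots,n$.
   Context: $APA$ is the continuous-logic theory of atomless probability algebras $(\mathcal{B},\mu,d)$ (signature $0,1,\cdot^c,\cap,\cup,\mu,d$, with $d(a,b)=\mu(a\triangle b)$). A $\kappa$-universal domain $\mathcal{U}$ is a $\kappa$-saturated, strongly $\kappa$-homogeneous model; a subset is small if of cardinality $<\kappa$. $\mathcal{U}$ is (isomorphic to) the probability algebra of a probability space $(X,\mathcal{A},\nu)$ (the quotient of $\mathcal{A}$ by null sets); $\langle C\rangle$ is the $\sigma$-subalgebra generated by $C$, which corresponds to a $\sigma$-subalgebra $\mathcal{D}$ of $\mathcal{A}$; $\mathbb{P}(a\mid\langle C\rangle)$ is the conditional expectation $\mathbb{E}(\chi_A\mid\mathcal{D})$ where $a$ is the class of $A$, and $\|\cdot\|_1$ is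 the $L_1(\nu)$ norm. A partition of $1$ is a tuple of pairwise disjoint elements with join $1$. The induced metric on types is $d(p,q)=\inf\{\max_i d(a_i,b_i):(a_i)_i\models p,(b_i)_i\models q\}$. *)

theory Defs
  imports "HOL-Probability.Probability"
begin

unbundle cardinal_syntax

section \<open>Continuous logic in the signature of probability algebras\<close>

record 'a pr_struct =
  pcarrier :: "'a set"
  pzero :: 'a
  pone :: 'a
  pcompl :: "'a \<Rightarrow> 'a"
  pinter :: "'a \<Rightarrow> 'a \<Rightarrow> 'a"
  punion :: "'a \<Rightarrow> 'a \<Rightarrow> 'a"
  pmu :: "'a \<Rightarrow> real"
  pdist :: "'a \<Rightarrow> 'a \<Rightarrow> real"

text \<open>
  A metric structure for this signature: the carrier is a complete metric space of diameter at
  most 1, the predicate \<open>pmu\<close> takes values in \<open>[0,1]\<close>, and the symbols respect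
  the moduli of uniform continuity of the signature, \<open>\<Delta>(\<epsilon>) = \<epsilon>\<close> for
  complement and measure and \<open>\<Delta>(\<epsilon>) = \<epsilon>/2\<close> for the two binary operations
  (pairs carry the maximum metric).
\<close>

definition metric_structure :: "'a pr_struct \<Rightarrow> bool" where
  "metric_structure U \<longleftrightarrow>
     Metric_space (pcarrier U) (pdist U) \<and>
     Metric_space.mcomplete (pcarrier U) (pdist U) \<and>
     (\<forall>x\<in>pcarrier U. \<forall>y\<in>pcarrier U. pdist U x y \<le> 1) \<and>
     pzero U \<in> pcarrier U \<and> pone U \<in> pcarrier U \<and>
     (\<forall>x\<in>pcarrier U. pcompl U x \<in> pcarrier U) \<and>
     (\<forall>x\<in>pcarrier U. \<forall>y\<in>pcarrier U. pinter U x y \<in> pcarrier U) \<and>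
     (\<forall>x\<in>pcarrier U. \<forall>y\<in>pcarrier U. punion U x y \<in> pcarrier U) \<and>
     (\<forall>x\<in>pcarrier U. pmu U x \<in> {0..1}) \<and>
     (\<forall>\<epsilon>>0. \<forall>x\<in>pcarrier U. \<forall>y\<in>pcarrier U. pdist U x y < \<epsilon> \<longrightarrow>
        pdist U (pcompl U x) (pcompl U y) \<le> \<epsilon>) \<and>
     (\<forall>\<epsilon>>0. \<forall>x\<in>pcarrier U. \<forall>y\<in>pcarrier U. pdist U x y < \<epsilon> \<longrightarrow>
        \<bar>pmu U x - pmu U y\<bar> \<le> \<epsilon>) \<and>
     (\<forall>\<epsilon>>0. \<forall>x\<in>pcarrier U. \<forall>x'\<in>pcarrier U. \<forall>y\<in>pcarrier U. \<forall>y'\<in>pcarrier U.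
        max (pdist U x x') (pdist U y y') < \<epsilon> / 2 \<longrightarrow>
        pdist U (pinter U x y) (pinter U x' y') \<le> \<epsilon> \<and>
        pdist U (punion U x y) (punion U x' y') \<le> \<epsilon>)"

definition pr_iso :: "'a pr_struct \<Rightarrow> 'b pr_struct \<Rightarrow> ('a \<Rightarrow> 'b) \<Rightarrow> bool" where
  "pr_iso U V h \<longleftrightarrow>
     bij_betw h (pcarrier U) (pcarrier V) \<and>
     h (pzero U) = pzero V \<and> h (pone U) = pone V \<and>
     (\<forall>x\<in>pcarrier U. h (pcompl U x) = pcompl V (h x)) \<and>
     (\<forall>x\<in>pcarrier U. \<forall>y\<in>pcarrier U. h (pinter U x y) = pinter V (h x) (h y)) \<and>
     (\<forall>x\<in>pcarrier U. \<forall>y\<in>pcarrier U. h (punion U x y) = punion V (h x) (h y)) \<and>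
     (\<forall>x\<in>pcarrier U. pmu V (h x) = pmu U x) \<and>
     (\<forall>x\<in>pcarrier U. \<forall>y\<in>pcarrier U. pdist V (h x) (h y) = pdist U x y)"

text \<open>
  The type parameter supplies the constant symbols of an expanded signature \<open>L(C)\<close>: there,
  the constants are elements of the structure and are interpreted by themselves.
\<close>

datatype (tconsts: 'c) tm =
    Var nat
  | Const 'c
  | TZero
  | TOne
  | Cpl "'c tm"
  | Meet "'c tm" "'c tm"
  | Join "'c tm" "'c tm"

primrec tvars :: "'c tm \<Rightarrow> nat set" where
  "tvars (Var i) = {i}"
| "tvars (Const c) = {}"
| "tvars TZero = {}"
| "tvars TOne = {}"
| "tvars (Cpl t) = tvars t"
| "tvars (Meet s t) = tvars s \<union> tvars t"
| "tvars (Join s t) = tvars s \<union> tvars t"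

primrec tval :: "'a pr_struct \<Rightarrow> 'a tm \<Rightarrow> (nat \<Rightarrow> 'a) \<Rightarrow> 'a" where
  "tval U (Var i) v = v i"
| "tval U (Const c) v = c"
| "tval U TZero v = pzero U"
| "tval U TOne v = pone U"
| "tval U (Cpl t) v = pcompl U (tval U t v)"
| "tval U (Meet s t) v = pinter U (tval U s v) (tval U t v)"
| "tval U (Join s t) v = punion U (tval U s v) (tval U t v)"

text \<open>
  \<open>Conn u [\<phi>\<^sub>0, \<dots>, \<phi>\<^sub>k\<^sub>-\<^sub>1]\<close> applies the connective \<open>u : [0,1]\<^sup>k \<rightarrow> [0,1]\<close>, where the cube is
  \<open>{..<k} \<rightarrow>\<^sub>E {0..1}\<close>. As in continuous logic, every continuous function on the cube
  is a connective; \<open>wf_fm\<close> imposes continuity.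
\<close>

datatype (fconsts: 'c) fm =
    Mu "'c tm"
  | Dist "'c tm" "'c tm"
  | Conn "(nat \<Rightarrow> real) \<Rightarrow> real" "'c fm list"
  | SupQ nat "'c fm"
  | InfQ nat "'c fm"

definition connective :: "nat \<Rightarrow> ((nat \<Rightarrow> real) \<Rightarrow> real) \<Rightarrow> bool" where
  "connective k u \<longleftrightarrow>
     continuous_on ({..<k} \<rightarrow>\<^sub>E {0..1}) u \<and> u \<in> ({..<k} \<rightarrow>\<^sub>E {0..1}) \<rightarrow> {0..1}"

fun wf_fm :: "'c fm \<Rightarrow> bool" where
  "wf_fm (Mu t) \<longleftrightarrow> True"
| "wf_fm (Dist s t) \<longleftrightarrow> True"
| "wf_fm (Conn u \<phi>s) \<longleftrightarrow> connective (length \<phi>s) u \<and> (\<forall>\<phi>\<in>set \<phi>s. wf_fm \<phi>)"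
| "wf_fm (SupQ i \<phi>) \<longleftrightarrow> wf_fm \<phi>"
| "wf_fm (InfQ i \<phi>) \<longleftrightarrow> wf_fm \<phi>"

fun fvars :: "'c fm \<Rightarrow> nat set" where
  "fvars (Mu t) = tvars t"
| "fvars (Dist s t) = tvars s \<union> tvars t"
| "fvars (Conn u \<phi>s) = (\<Union>\<phi>\<in>set \<phi>s. fvars \<phi>)"
| "fvars (SupQ i \<phi>) = fvars \<phi> - {i}"
| "fvars (InfQ i \<phi>) = fvars \<phi> - {i}"

fun fval :: "'a pr_struct \<Rightarrow> 'a fm \<Rightarrow> (nat \<Rightarrow> 'a) \<Rightarrow> real" where
  "fval U (Mu t) v = pmu U (tval U t v)"
| "fval U (Dist s t) v = pdist U (tval U s v) (tval U t v)"
| "fval U (Conn u \<phi>s) v = u (\<lambda>j\<in>{..<length \<phi>s}. map (\<lambda>\<phi>. fval U \<phi> v) \<phi>s ! j)"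
| "fval U (SupQ i \<phi>) v = (SUP x\<in>pcarrier U. fval U \<phi> (v(i := x)))"
| "fval U (InfQ i \<phi>) v = (INF x\<in>pcarrier U. fval U \<phi> (v(i := x)))"

text \<open>
  A tuple of length \<open>n\<close> is a function on \<open>nat\<close> of which only the values at
  \<open>i < n\<close> matter; accordingly the free variables of a formula in \<open>n\<close> variables are numbered
  from 0. The \<open>L(A)\<close>-conditions are the statements \<open>\<phi> = 0\<close> with \<open>\<phi>\<close> an \<open>L(A)\<close>-formula,
  and a set of conditions is represented by the set of these formulas.
\<close>

definition formulas :: "'c set \<Rightarrow> nat \<Rightarrow> 'c fm set" where
  "formulas A n = {\<phi>. wf_fm \<phi> \<and> fconsts \<phi> \<subseteq> A \<and> fvars \<phi> \<subseteq> {..<n}}"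

definition realizes :: "'a pr_struct \<Rightarrow> nat \<Rightarrow> (nat \<Rightarrow> 'a) \<Rightarrow> 'a fm set \<Rightarrow> bool" where
  "realizes U n a \<Gamma> \<longleftrightarrow> a \<in> {..<n} \<rightarrow> pcarrier U \<and> (\<forall>\<phi>\<in>\<Gamma>. fval U \<phi> a = 0)"

definition models :: "'a pr_struct \<Rightarrow> 'a fm set \<Rightarrow> bool" where
  "models U T \<longleftrightarrow> metric_structure U \<and> (\<forall>\<sigma>\<in>T. \<forall>v. fval U \<sigma> v = 0)"

definition tp :: "'a pr_struct \<Rightarrow> nat \<Rightarrow> 'a set \<Rightarrow> (nat \<Rightarrow> 'a) \<Rightarrow> 'a fm set" where
  "tp U n C a = {\<phi>\<in>formulas C n. fval U \<phi> a = 0}"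

definition type_dist :: "'a pr_struct \<Rightarrow> nat \<Rightarrow> 'a fm set \<Rightarrow> 'a fm set \<Rightarrow> real" where
  "type_dist U n p q =
     Inf {(MAX i\<in>{..<n}. pdist U (a i) (b i)) | a b. realizes U n a p \<and> realizes U n b q}"


section \<open>Universal domains\<close>

definition saturated :: "'k rel \<Rightarrow> 'a pr_struct \<Rightarrow> bool" where
  "saturated \<kappa> U \<longleftrightarrow>
     (\<forall>A n \<Gamma>. A \<subseteq> pcarrier U \<and> |A| <o \<kappa> \<and> \<Gamma> \<subseteq> formulas A n \<and>
        (\<forall>\<Gamma>\<^sub>0\<subseteq>\<Gamma>. finite \<Gamma>\<^sub>0 \<longrightarrow> (\<exists>a. realizes U n a \<Gamma>\<^sub>0)) \<longrightarrow>
        (\<exists>a. realizes U n a \<Gamma>))"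

definition elementary_map :: "'a pr_struct \<Rightarrow> 'a set \<Rightarrow> ('a \<Rightarrow> 'a) \<Rightarrow> bool" where
  "elementary_map U A f \<longleftrightarrow>
     f \<in> A \<rightarrow> pcarrier U \<and>
     (\<forall>n. \<forall>\<phi>\<in>formulas {} n. \<forall>v\<in>{..<n} \<rightarrow> A. fval U \<phi> (f \<circ> v) = fval U \<phi> v)"

definition strongly_homogeneous :: "'k rel \<Rightarrow> 'a pr_struct \<Rightarrow> bool" where
  "strongly_homogeneous \<kappa> U \<longleftrightarrow>
     (\<forall>A f. A \<subseteq> pcarrier U \<and> |A| <o \<kappa> \<and> elementary_map U A f \<longrightarrow>
        (\<exists>h. pr_iso U U h \<and> (\<forall>x\<in>A. h x = f x)))"

definition universal_domain :: "'k rel \<Rightarrow> 'a fm set \<Rightarrow> 'a pr_struct \<Rightarrow> bool" where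
  "universal_domain \<kappa> T U \<longleftrightarrow> models U T \<and> saturated \<kappa> U \<and> strongly_homogeneous \<kappa> U"


section \<open>The theory of atomless probability algebras\<close>

definition dotminus :: "'c fm \<Rightarrow> 'c fm \<Rightarrow> 'c fm" where
  "dotminus \<phi> \<psi> = Conn (\<lambda>v. max 0 (v 0 - v 1)) [\<phi>, \<psi>]"

definition absdiff :: "'c fm \<Rightarrow> 'c fm \<Rightarrow> 'c fm" where
  "absdiff \<phi> \<psi> = Conn (\<lambda>v. \<bar>v 0 - v 1\<bar>) [\<phi>, \<psi>]"

definition one_minus :: "'c fm \<Rightarrow> 'c fm" where
  "one_minus \<phi> = Conn (\<lambda>v. 1 - v 0) [\<phi>]"

abbreviation (input) all3 :: "'c fm \<Rightarrow> 'c fm" where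
  "all3 \<phi> \<equiv> SupQ 0 (SupQ 1 (SupQ 2 \<phi>))"

text \<open>The Boolean identity \<open>s = t\<close> in the first three variables is the condition \<open>sup d(s,t) = 0\<close>.\<close>

definition boolean_axioms :: "'c fm set" where
  "boolean_axioms = (let x = Var 0; y = Var 1; z = Var 2 in
    {all3 (Dist (Meet x y) (Meet y x)),
     all3 (Dist (Join x y) (Join y x)),
     all3 (Dist (Meet x (Meet y z)) (Meet (Meet x y) z)),
     all3 (Dist (Join x (Join y z)) (Join (Join x y) z)),
     all3 (Dist (Meet x (Join x y)) x),
     all3 (Dist (Join x (Meet x y)) x),
     all3 (Dist (Meet x (Join y z)) (Join (Meet x y) (Meet x z))),
     all3 (Dist (Join x (Meet y z)) (Meet (Join x y) (Join x z))),
     all3 (Dist (Meet x (Cpl x)) TZero),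
     all3 (Dist (Join x (Cpl x)) TOne)})"

text \<open>
  The third and fourth axioms are monotonicity, the fifth is modularity
  \<open>\<mu>(x) - \<mu>(x \<inter> y) = \<mu>(x \<union> y) - \<mu>(y)\<close>.
\<close>

definition measure_axioms :: "'c fm set" where
  "measure_axioms = (let x = Var 0; y = Var 1 in
    {Mu TZero,
     one_minus (Mu TOne),
     SupQ 0 (SupQ 1 (dotminus (Mu (Meet x y)) (Mu x))),
     SupQ 0 (SupQ 1 (dotminus (Mu x) (Mu (Join x y)))),
     SupQ 0 (SupQ 1 (absdiff (dotminus (Mu x) (Mu (Meet x y))) (dotminus (Mu (Join x y)) (Mu y)))),
     SupQ 0 (SupQ 1 (absdiff (Dist x y) (Mu (Join (Meet x (Cpl y)) (Meet (Cpl x) y)))))})"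

definition atomless_axiom :: "'c fm" where
  "atomless_axiom = (let x = Var 0; y = Var 1 in
     SupQ 0 (InfQ 1 (absdiff (Mu (Meet x y)) (Mu (Meet x (Cpl y))))))"

definition APA :: "'c fm set" where
  "APA = boolean_axioms \<union> measure_axioms \<union> {atomless_axiom}"

lemma connectives:
  "connective 2 (\<lambda>v. max 0 (v 0 - v 1))"
  "connective 2 (\<lambda>v. \<bar>v 0 - v 1\<bar>)"
  "connective 1 (\<lambda>v. 1 - v 0)"
proof -
  have coord: "continuous_on S (\<lambda>v. v i)" for S :: "(nat \<Rightarrow> real) set" and i
    by (rule continuous_on_subset[OF continuous_on_product_coordinates]) simp
  have bounds: "v i \<in> {0..1}" if "v \<in> {..<k} \<rightarrow>\<^sub>E {0..1}" "i < k"
    for v :: "nat \<Rightarrow> real" and i k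
    using PiE_mem[OF that(1)] that(2) by simp
  have rng: "0 \<le> v 0 \<and> v 0 \<le> 1 \<and> 0 \<le> v 1 \<and> v 1 \<le> 1" if "v \<in> {..<2} \<rightarrow>\<^sub>E {0..1}"
    for v :: "nat \<Rightarrow> real"
    using bounds[OF that, of 0] bounds[OF that, of 1] by simp
  have rng1: "0 \<le> v 0 \<and> v 0 \<le> 1" if "v \<in> {..<1} \<rightarrow>\<^sub>E {0..1}" for v :: "nat \<Rightarrow> real"
    using bounds[OF that, of 0] by simp
  have "max 0 (v 0 - v 1) \<in> {0..1} \<and> \<bar>v 0 - v 1\<bar> \<in> {0..1}"
    if "v \<in> {..<2} \<rightarrow>\<^sub>E {0..1}" for v :: "nat \<Rightarrow> real"
    using rng[OF that] by (simp add: abs_le_iff)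
  note rng2 = this
  show "connective 2 (\<lambda>v. max 0 (v 0 - v 1))"
    unfolding connective_def
    by (intro conjI funcsetI continuous_on_max continuous_on_diff continuous_on_const coord)
      (rule conjunct1[OF rng2])
  show "connective 2 (\<lambda>v. \<bar>v 0 - v 1\<bar>)"
    unfolding connective_def
    by (intro conjI funcsetI continuous_on_rabs continuous_on_diff coord) (rule conjunct2[OF rng2])
  have "1 - v 0 \<in> {0..1}" if "v \<in> {..<1} \<rightarrow>\<^sub>E {0..1}" for v :: "nat \<Rightarrow> real"
    using rng1[OF that] by simp
  then show "connective 1 (\<lambda>v. 1 - v 0)"
    unfolding connective_def by (intro conjI funcsetI continuous_on_diff continuous_on_const coord)
qed

lemma APA_sentences: "APA \<subseteq> formulas {} 0"
  using connectives
  by (auto simp: APA_def boolean_axioms_def measure_axioms_def atomless_axiom_def formulas_def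
      dotminus_def absdiff_def one_minus_def Let_def numeral_2_eq_2)


section \<open>Partitions and generated subalgebras\<close>

definition ple :: "'a pr_struct \<Rightarrow> 'a \<Rightarrow> 'a \<Rightarrow> bool" where
  "ple U x y \<longleftrightarrow> pinter U x y = x"

definition is_join :: "'a pr_struct \<Rightarrow> 'a set \<Rightarrow> 'a \<Rightarrow> bool" where
  "is_join U X s \<longleftrightarrow> s \<in> pcarrier U \<and> (\<forall>x\<in>X. ple U x s) \<and>
     (\<forall>t\<in>pcarrier U. (\<forall>x\<in>X. ple U x t) \<longrightarrow> ple U s t)"

definition partition_of_one :: "'a pr_struct \<Rightarrow> nat \<Rightarrow> (nat \<Rightarrow> 'a) \<Rightarrow> bool" where
  "partition_of_one U n a \<longleftrightarrow> a \<in> {..<n} \<rightarrow> pcarrier U \<and>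
     (\<forall>i<n. \<forall>j<n. i \<noteq> j \<longrightarrow> pinter U (a i) (a j) = pzero U) \<and>
     is_join U (a ` {..<n}) (pone U)"

definition sigma_subalgebra :: "'a pr_struct \<Rightarrow> 'a set \<Rightarrow> bool" where
  "sigma_subalgebra U S \<longleftrightarrow> S \<subseteq> pcarrier U \<and> pzero U \<in> S \<and> pone U \<in> S \<and>
     (\<forall>x\<in>S. pcompl U x \<in> S) \<and>
     (\<forall>x\<in>S. \<forall>y\<in>S. pinter U x y \<in> S \<and> punion U x y \<in> S) \<and>
     (\<forall>X s. X \<subseteq> S \<and> countable X \<and> is_join U X s \<longrightarrow> s \<in> S)"

definition gen :: "'a pr_struct \<Rightarrow> 'a set \<Rightarrow> 'a set" where
  "gen U C = sigma_subalgebra U hull C"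


section \<open>The probability algebra of a probability space\<close>

definition null_rel :: "'x measure \<Rightarrow> 'x set rel" where
  "null_rel M = {(A, B). A \<in> sets M \<and> B \<in> sets M \<and> measure M (sym_diff A B) = 0}"

definition cls :: "'x measure \<Rightarrow> 'x set \<Rightarrow> 'x set set" where
  "cls M A = null_rel M `` {A}"

definition rep :: "'x set set \<Rightarrow> 'x set" where
  "rep X = (SOME A. A \<in> X)"

definition prob_algebra_of :: "'x measure \<Rightarrow> 'x set set pr_struct" where
  "prob_algebra_of M =
     \<lparr> pcarrier = sets M // null_rel M,
       pzero = cls M {},
       pone = cls M (space M),
       pcompl = (\<lambda>X. cls M (space M - rep X)),
       pinter = (\<lambda>X Y. cls M (rep X \<inter> rep Y)),
       punion = (\<lambda>X Y. cls M (rep X \<union> rep Y)),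
       pmu = (\<lambda>X. measure M (rep X)),
       pdist = (\<lambda>X Y. measure M (sym_diff (rep X) (rep Y))) \<rparr>"

text \<open>
  In the following, \<open>h\<close> is an isomorphism from \<open>U\<close> onto \<open>prob_algebra_of M\<close>.
  The events whose class lies in the subalgebra \<open>S\<close> are the members of the classes in \<open>h ` S\<close>.
\<close>

definition corr_sigma :: "'x measure \<Rightarrow> ('a \<Rightarrow> 'x set set) \<Rightarrow> 'a set \<Rightarrow> 'x measure" where
  "corr_sigma M h S = sigma (space M) (\<Union>(h ` S))"

definition cprob :: "'x measure \<Rightarrow> ('a \<Rightarrow> 'x set set) \<Rightarrow> 'a set \<Rightarrow> 'a \<Rightarrow> 'x \<Rightarrow> real" where
  "cprob M h S a = real_cond_exp M (corr_sigma M h S) (indicator (rep (h a)))"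

definition L1_norm :: "'x measure \<Rightarrow> ('x \<Rightarrow> real) \<Rightarrow> real" where
  "L1_norm M f = (\<integral>x. \<bar>f x\<bar> \<partial>M)"

end

theory Submission
  imports Defs
begin

text \<open>
  \<open>U\<close> is replaced by the events of \<open>M\<close>, up to null sets. Atomlessness and
  saturation make every event divisible: it contains events of every smaller measure. Hence the
  joint distribution of a finite tuple of events extends along any new event, a back-and-forth
  argument that gives quantifier elimination; so the type of a partition \<open>v\<close> over
  \<open>C\<close> is determined by the measures of \<open>v i \<inter> t\<close> for \<open>t\<close> in the
  Boolean algebra generated by \<open>C\<close>.

  The lower bound for the distance is obtained by integrating the difference \<open>f\<close> of the two
  conditional probabilities over \<open>{f \<ge> 0}\<close> and its complement. For the partition \<open>b'\<close>,
  saturation reduces the problem to a finite subset of \<open>C\<close>, which cuts the space into finitely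
  many cells \<open>Q\<close>. In each of them one keeps a piece of \<open>a i\<close> of measure
  \<open>min (prob (a i \<inter> Q)) (prob (b i \<inter> Q))\<close> and redistributes the remainder, which moves
  \<open>a i\<close> by \<open>\<Sum>Q. \<bar>prob (a i \<inter> Q) - prob (b i \<inter> Q)\<bar>\<close>. This sum is at most the
  \<open>L\<^sub>1\<close> distance of the conditional probabilities.
\<close>

section \<open>Events representing the elements of a structure\<close>

context prob_space
begin

lemma AE_iff_prob_sym_diff:
  assumes "A \<in> events" "B \<in> events"
  shows "(AE x in M. x \<in> A \<longleftrightarrow> x \<in> B) \<longleftrightarrow> prob (sym_diff A B) = 0"
proof -
  have "prob (sym_diff A B) = 0 \<longleftrightarrow> (AE x in M. x \<notin> sym_diff A B)"
    using assms by (intro prob_eq_0) auto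
  also have "\<dots> \<longleftrightarrow> (AE x in M. x \<in> A \<longleftrightarrow> x \<in> B)"
    by (intro AE_cong) auto
  finally show ?thesis by simp
qed

lemma equiv_null_rel: "equiv events (null_rel M)"
proof -
  \<comment> \<open>Written as almost sure equality, the relation is visibly symmetric and
    transitive.\<close>
  have *: "null_rel M = {(A, B). A \<in> events \<and> B \<in> events \<and> (AE x in M. x \<in> A \<longleftrightarrow> x \<in> B)}"
    unfolding null_rel_def using AE_iff_prob_sym_diff by auto
  show ?thesis
    unfolding * by (intro equivI refl_onI symI transI) auto
qed

text \<open>\<open>rep\<close> chooses an arbitrary member of a class, so the original event comes
  back only up to a null set. This is why the translations below hold almost everywhere.\<close>

lemma rep_cls:
  assumes "A \<in> events"
  shows "rep (cls M A) \<in> events" "AE x in M. x \<in> rep (cls M A) \<longleftrightarrow> x \<in> A"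
proof -
  have "A \<in> cls M A"
    using assms equiv_null_rel by (auto simp: cls_def equiv_def refl_on_def)
  then have "rep (cls M A) \<in> cls M A"
    unfolding rep_def by (rule someI)
  then have r: "rep (cls M A) \<in> events" "prob (sym_diff A (rep (cls M A))) = 0"
    by (auto simp: cls_def null_rel_def)
  then show "rep (cls M A) \<in> events" by simp
  have "AE x in M. x \<in> A \<longleftrightarrow> x \<in> rep (cls M A)"
    using r assms AE_iff_prob_sym_diff by blast
  then show "AE x in M. x \<in> rep (cls M A) \<longleftrightarrow> x \<in> A"
    by auto
qed

end

locale represented_structure = prob_space M for M :: "'x measure" +
  fixes U :: "'a pr_struct" and h :: "'a \<Rightarrow> 'x set set"
  assumes metric_structure: "metric_structure U"
    and iso: "pr_iso U (prob_algebra_of M) h"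
begin

text \<open>A fixed event in the class \<open>h u\<close>. Equations between elements of
  \<open>U\<close> become almost sure equalities of such events, to which measure theory applies
  directly.\<close>

definition ev :: "'a \<Rightarrow> 'x set" where "ev u = rep (h u)"

lemma carrier_closed [simp, intro]:
  "pzero U \<in> pcarrier U" "pone U \<in> pcarrier U"
  "x \<in> pcarrier U \<Longrightarrow> pcompl U x \<in> pcarrier U"
  "x \<in> pcarrier U \<Longrightarrow> y \<in> pcarrier U \<Longrightarrow> pinter U x y \<in> pcarrier U"
  "x \<in> pcarrier U \<Longrightarrow> y \<in> pcarrier U \<Longrightarrow> punion U x y \<in> pcarrier U"
  using metric_structure unfolding metric_structure_def by blast+

lemma h_class:
  assumes "u \<in> pcarrier U"
  shows "h u = cls M (ev u)" "ev u \<in> events"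
proof -
  have "h u \<in> events // null_rel M"
    using iso assms by (auto simp: pr_iso_def prob_algebra_of_def bij_betw_def)
  then obtain A where A: "A \<in> events" "h u = cls M A"
    by (auto simp: quotient_def cls_def)
  from rep_cls[OF A(1)] A show e: "ev u \<in> events"
    by (simp add: ev_def)
  have "AE x in M. x \<in> A \<longleftrightarrow> x \<in> ev u"
    using rep_cls(2)[OF A(1)] A by (auto simp: ev_def)
  then have "(A, ev u) \<in> null_rel M"
    using e A AE_iff_prob_sym_diff by (auto simp: null_rel_def)
  then show "h u = cls M (ev u)"
    using A equiv_class_eq[OF equiv_null_rel] by (simp add: cls_def)
qed

lemma ev_events [measurable, simp, intro]: "u \<in> pcarrier U \<Longrightarrow> ev u \<in> events"
  by (rule h_class)

text \<open>The whole class is described, not just one representative, because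
  \<open>corr_sigma\<close> is generated by all members of the classes.\<close>

lemma h_members:
  assumes "u \<in> pcarrier U"
  shows "h u = {A \<in> events. AE x in M. x \<in> ev u \<longleftrightarrow> x \<in> A}"
  using assms AE_iff_prob_sym_diff[OF ev_events[OF assms]]
  by (auto simp: h_class(1)[OF assms] cls_def null_rel_def)

text \<open>Surjectivity of \<open>h\<close>. Events built by measure theory are turned back into
  elements of \<open>U\<close> through this fact.\<close>

lemma ev_surj:
  assumes "A \<in> events"
  obtains u where "u \<in> pcarrier U" "AE x in M. x \<in> ev u \<longleftrightarrow> x \<in> A"
proof -
  have "cls M A \<in> events // null_rel M"
    using assms by (auto simp: cls_def quotient_def)
  moreover have "h ` pcarrier U = events // null_rel M"
    using iso by (auto simp: pr_iso_def prob_algebra_of_def bij_betw_def)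
  ultimately obtain u where "u \<in> pcarrier U" "h u = cls M A"
    by (metis imageE)
  then show ?thesis
    using that rep_cls[OF assms] by (simp add: ev_def)
qed

section \<open>Boolean operations, measure and metric in terms of events\<close>

lemma ev_zero: "AE x in M. x \<notin> ev (pzero U)"
  and ev_one: "AE x in M. x \<in> ev (pone U)"
proof -
  have h: "h (pzero U) = cls M {}" "h (pone U) = cls M (space M)"
    using iso by (auto simp: pr_iso_def prob_algebra_of_def)
  show "AE x in M. x \<notin> ev (pzero U)"
    using rep_cls(2)[of "{}"] h by (simp add: ev_def)
  show "AE x in M. x \<in> ev (pone U)"
    using rep_cls(2)[of "space M"] AE_space h by (simp add: ev_def)
qed

lemma ev_compl:
  assumes "u \<in> pcarrier U"
  shows "AE x in M. x \<in> ev (pcompl U u) \<longleftrightarrow> x \<notin> ev u"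
proof -
  have "h (pcompl U u) = cls M (space M - ev u)"
    using iso assms by (auto simp: pr_iso_def prob_algebra_of_def ev_def)
  then show ?thesis
    using rep_cls(2)[of "space M - ev u"] assms AE_space by (auto simp: ev_def[symmetric] ev_def[of "pcompl U u"])
qed

lemma
  assumes "u \<in> pcarrier U" "v \<in> pcarrier U"
  shows ev_inter: "AE x in M. x \<in> ev (pinter U u v) \<longleftrightarrow> x \<in> ev u \<and> x \<in> ev v"
    and ev_union: "AE x in M. x \<in> ev (punion U u v) \<longleftrightarrow> x \<in> ev u \<or> x \<in> ev v"
proof -
  have h: "h (pinter U u v) = cls M (ev u \<inter> ev v)" "h (punion U u v) = cls M (ev u \<union> ev v)"
    using iso assms by (auto simp: pr_iso_def prob_algebra_of_def ev_def)
  show "AE x in M. x \<in> ev (pinter U u v) \<longleftrightarrow> x \<in> ev u \<and> x \<in> ev v"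
    using rep_cls(2)[of "ev u \<inter> ev v"] assms h by (auto simp: ev_def[of "pinter U u v"])
  show "AE x in M. x \<in> ev (punion U u v) \<longleftrightarrow> x \<in> ev u \<or> x \<in> ev v"
    using rep_cls(2)[of "ev u \<union> ev v"] assms h by (auto simp: ev_def[of "punion U u v"])
qed

lemma pmu_ev: "u \<in> pcarrier U \<Longrightarrow> pmu U u = prob (ev u)"
  using iso by (auto simp: pr_iso_def prob_algebra_of_def ev_def)

lemma pdist_ev:
  "u \<in> pcarrier U \<Longrightarrow> v \<in> pcarrier U \<Longrightarrow> pdist U u v = prob (sym_diff (ev u) (ev v))"
  using iso by (auto simp: pr_iso_def prob_algebra_of_def ev_def)

lemma ev_eqI:
  assumes "u \<in> pcarrier U" "v \<in> pcarrier U" "AE x in M. x \<in> ev u \<longleftrightarrow> x \<in> ev v"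
  shows "u = v"
proof -
  have "h u = h v"
    using assms by (auto simp: h_members)
  then show ?thesis
    using iso assms by (auto simp: pr_iso_def bij_betw_def inj_on_def)
qed

lemma ev_eq_iff:
  assumes "u \<in> pcarrier U" "v \<in> pcarrier U"
  shows "u = v \<longleftrightarrow> (AE x in M. x \<in> ev u \<longleftrightarrow> x \<in> ev v)"
  using ev_eqI[OF assms] by auto

section \<open>Order, countable joins and partitions in terms of events\<close>

lemma ple_ev:
  assumes "u \<in> pcarrier U" "v \<in> pcarrier U"
  shows "ple U u v \<longleftrightarrow> (AE x in M. x \<in> ev u \<longrightarrow> x \<in> ev v)"
proof -
  have "ple U u v \<longleftrightarrow> (AE x in M. x \<in> ev (pinter U u v) \<longleftrightarrow> x \<in> ev u)"
    unfolding ple_def using assms by (subst ev_eq_iff) auto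
  also have "\<dots> \<longleftrightarrow> (AE x in M. x \<in> ev u \<longrightarrow> x \<in> ev v)"
    using ev_inter[OF assms] by (auto elim: AE_mp)
  finally show ?thesis .
qed

lemma prob_pinter:
  assumes "u \<in> pcarrier U" "v \<in> pcarrier U"
  shows "pmu U (pinter U u v) = prob (ev u \<inter> ev v)"
proof -
  have "prob (ev (pinter U u v)) = prob (ev u \<inter> ev v)"
    using ev_inter[OF assms] assms by (intro finite_measure_eq_AE) auto
  then show ?thesis
    using assms by (simp add: pmu_ev)
qed

text \<open>A join refers only to the order of \<open>U\<close>. Since \<open>X\<close> is
  countable, the union of the representatives is an event and is realized by some \<open>v\<close>.
  Leastness of \<open>s\<close> gives one inclusion; the other combines countably many null
  sets.\<close>

lemma is_join_ev:
  assumes X: "X \<subseteq> pcarrier U" "countable X" and s: "is_join U X s"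
  shows "AE x in M. x \<in> ev s \<longleftrightarrow> x \<in> (\<Union>u\<in>X. ev u)"
proof -
  have sU: "s \<in> pcarrier U" and ub: "\<And>u. u \<in> X \<Longrightarrow> ple U u s"
    and least: "\<And>t. t \<in> pcarrier U \<Longrightarrow> (\<And>u. u \<in> X \<Longrightarrow> ple U u t) \<Longrightarrow> ple U s t"
    using s by (auto simp: is_join_def)
  have "(\<Union>u\<in>X. ev u) \<in> events"
    using X by (intro sets.countable_UN') auto
  then obtain v where v: "v \<in> pcarrier U" "AE x in M. x \<in> ev v \<longleftrightarrow> x \<in> (\<Union>u\<in>X. ev u)"
    by (rule ev_surj)
  have "ple U u v" if "u \<in> X" for u
  proof -
    have "AE x in M. x \<in> ev u \<longrightarrow> x \<in> ev v"
      using v(2) by eventually_elim (use that in auto)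
    then show ?thesis using that X v by (subst ple_ev) auto
  qed
  then have "ple U s v" using least v by auto
  then have 1: "AE x in M. x \<in> ev s \<longrightarrow> x \<in> ev v"
    using sU v by (simp add: ple_ev)
  have "AE x in M. \<forall>u\<in>X. x \<in> ev u \<longrightarrow> x \<in> ev s"
    using ub X sU by (subst AE_ball_countable) (auto simp: ple_ev subset_iff)
  then show ?thesis
    using 1 v(2) by eventually_elim auto
qed

lemma is_joinI:
  assumes X: "X \<subseteq> pcarrier U" "countable X" and s: "s \<in> pcarrier U"
    and eq: "AE x in M. x \<in> ev s \<longleftrightarrow> x \<in> (\<Union>u\<in>X. ev u)"
  shows "is_join U X s"
  unfolding is_join_def
proof (intro conjI ballI impI)
  fix u assume "u \<in> X"
  moreover have "AE x in M. x \<in> ev u \<longrightarrow> x \<in> ev s"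
    using eq by eventually_elim (use \<open>u \<in> X\<close> in auto)
  ultimately show "ple U u s" using X s by (subst ple_ev) auto
next
  fix t assume t: "t \<in> pcarrier U" "\<forall>u\<in>X. ple U u t"
  have "AE x in M. \<forall>u\<in>X. x \<in> ev u \<longrightarrow> x \<in> ev t"
    using t X by (subst AE_ball_countable) (auto simp: ple_ev subset_iff)
  then have "AE x in M. x \<in> ev s \<longrightarrow> x \<in> ev t"
    using eq by eventually_elim auto
  then show "ple U s t" using s t by (simp add: ple_ev)
qed (use s in auto)

lemma partition_of_one_ev:
  assumes "a \<in> {..<n} \<rightarrow> pcarrier U"
  shows "partition_of_one U n a \<longleftrightarrow>
    (\<forall>i<n. \<forall>j<n. i \<noteq> j \<longrightarrow> prob (ev (a i) \<inter> ev (a j)) = 0) \<and>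
    (AE x in M. \<exists>i<n. x \<in> ev (a i))"
proof -
  have inU: "a i \<in> pcarrier U" if "i < n" for i using assms that by auto
  have 1: "pinter U (a i) (a j) = pzero U \<longleftrightarrow> prob (ev (a i) \<inter> ev (a j)) = 0"
    if "i < n" "j < n" for i j
  proof -
    have "pinter U (a i) (a j) = pzero U \<longleftrightarrow>
        (AE x in M. x \<in> ev (pinter U (a i) (a j)) \<longleftrightarrow> x \<in> ev (pzero U))"
      using that inU by (subst ev_eq_iff) auto
    also have "\<dots> \<longleftrightarrow> (AE x in M. x \<notin> ev (a i) \<inter> ev (a j))"
      using ev_zero ev_inter[OF inU[OF that(1)] inU[OF that(2)]]
      by (auto elim: AE_mp)
    also have "\<dots> \<longleftrightarrow> prob (ev (a i) \<inter> ev (a j)) = 0"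
      using that inU by (subst prob_eq_0) auto
    finally show ?thesis .
  qed
  have X: "a ` {..<n} \<subseteq> pcarrier U" "countable (a ` {..<n})" using inU by auto
  have 2: "is_join U (a ` {..<n}) (pone U) \<longleftrightarrow> (AE x in M. \<exists>i<n. x \<in> ev (a i))"
  proof
    assume "is_join U (a ` {..<n}) (pone U)"
    from is_join_ev[OF X this] ev_one show "AE x in M. \<exists>i<n. x \<in> ev (a i)"
      by eventually_elim auto
  next
    assume "AE x in M. \<exists>i<n. x \<in> ev (a i)"
    then have "AE x in M. x \<in> ev (pone U) \<longleftrightarrow> x \<in> (\<Union>u\<in>a ` {..<n}. ev u)"
      using ev_one by eventually_elim auto
    then show "is_join U (a ` {..<n}) (pone U)"
      using X by (intro is_joinI) auto
  qed
  show ?thesis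
    unfolding partition_of_one_def using assms 1 2 by auto
qed

end

section \<open>Divisibility of events\<close>

text \<open>Conditions must have the form \<open>\<phi> = 0\<close>; truncation at 0 brings a closed
  inequality into this form. With \<open>s = 0\<close> the condition fixes the value
  \<open>r\<close>.\<close>

definition near :: "real \<Rightarrow> real \<Rightarrow> 'c fm \<Rightarrow> 'c fm" where
  "near r s \<phi> = Conn (\<lambda>v. max 0 (\<bar>v 0 - r\<bar> - s)) [\<phi>]"

lemma fval_near: "fval U (near r s \<phi>) v = 0 \<longleftrightarrow> \<bar>fval U \<phi> v - r\<bar> \<le> s"
  by (auto simp: near_def max_def)

lemma near_formulas:
  assumes "\<phi> \<in> formulas A n" "0 \<le> r" "r \<le> 1" "0 \<le> s"
  shows "near r s \<phi> \<in> formulas A n"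
proof -
  have coord: "continuous_on S (\<lambda>v. v i)" for S :: "(nat \<Rightarrow> real) set" and i
    by (rule continuous_on_subset[OF continuous_on_product_coordinates]) simp
  have "connective 1 (\<lambda>v. max 0 (\<bar>v 0 - r\<bar> - s))"
    unfolding connective_def
  proof (intro conjI continuous_on_max continuous_on_diff continuous_on_rabs
      continuous_on_const coord funcsetI)
    fix v :: "nat \<Rightarrow> real" assume "v \<in> {..<1} \<rightarrow>\<^sub>E {0..1}"
    then have "v 0 \<in> {0..1}" by (rule PiE_mem) simp
    then show "max 0 (\<bar>v 0 - r\<bar> - s) \<in> {0..1}" using assms by auto
  qed
  then show ?thesis using assms by (auto simp: near_def formulas_def)
qed

section \<open>Exact divisibility and redistribution of mass in an atomless saturated
  structure\<close>

locale apa_domain = represented_structure M U h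
  for M :: "'x measure" and U :: "'a pr_struct" and h :: "'a \<Rightarrow> 'x set set" +
  fixes \<kappa> :: "'k rel"
  assumes card_order: "Card_order \<kappa>" and uncountable: "natLeq <o \<kappa>"
    and APA: "models U APA" and saturated: "saturated \<kappa> U"
begin

lemma small_finite: "finite A \<Longrightarrow> |A| <o \<kappa>"
  using finite_iff_ordLess_natLeq uncountable ordLess_transitive by blast

text \<open>An infinite cardinal absorbs binary unions. This allows the entries of a partition to be
  added to \<open>C\<close> as parameters of a type.\<close>

lemma small_Un:
  assumes "|A| <o \<kappa>" "|B| <o \<kappa>"
  shows "|A \<union> B| <o \<kappa>"
proof -
  have "\<not> finite (Field \<kappa>)"
    using card_order uncountable
    by (metis Field_natLeq card_of_Field_ordIso card_of_ordLeq_infinite infinite_UNIV_nat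
        natLeq_Card_order ordIso_iff_ordLeq ordLeq_ordIso_trans ordLess_imp_ordLeq ordIso_ordLeq_trans)
  then show ?thesis
    using assms card_order card_of_Un_ordLess_infinite_Field by blast
qed

text \<open>The atomless axiom is a supremum of infima equal to 0. It gives halving only up to
  \<open>\<epsilon>\<close>, since an infimum need not be attained.\<close>

lemma almost_halving:
  assumes A: "A \<in> events" and \<epsilon>: "\<epsilon> > 0"
  obtains B where "B \<in> events" "B \<subseteq> A" "\<bar>prob B - prob (A - B)\<bar> < \<epsilon>"
proof -
  obtain u where u: "u \<in> pcarrier U" "AE x in M. x \<in> ev u \<longleftrightarrow> x \<in> A"
    using A by (rule ev_surj)
  define d where "d x y = \<bar>pmu U (pinter U x y) - pmu U (pinter U x (pcompl U y))\<bar>" for x y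
  have d01: "0 \<le> d x y" "d x y \<le> 1" if "x \<in> pcarrier U" "y \<in> pcarrier U" for x y
  proof -
    have "pmu U (pinter U x y) \<in> {0..1}" "pmu U (pinter U x (pcompl U y)) \<in> {0..1}"
      using that by (auto simp: pmu_ev)
    then show "0 \<le> d x y" "d x y \<le> 1" by (auto simp: d_def)
  qed
  \<comment> \<open>The axiom is a sentence, so the assignment is a mere placeholder.\<close>
  have "fval U atomless_axiom (\<lambda>_. pzero U) = 0"
    using APA by (auto simp: models_def APA_def)
  then have sup0: "(SUP x\<in>pcarrier U. INF y\<in>pcarrier U. d x y) = 0"
    by (simp add: atomless_axiom_def absdiff_def Let_def d_def)
  have inf_le: "(INF y\<in>pcarrier U. d x y) \<le> d x y" if "x \<in> pcarrier U" "y \<in> pcarrier U" for x y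
    by (rule cINF_lower) (use that d01 in \<open>auto intro!: bdd_belowI\<close>)
  have "(INF y\<in>pcarrier U. d u y) \<le> (SUP x\<in>pcarrier U. INF y\<in>pcarrier U. d x y)"
  proof (rule cSUP_upper[OF u(1)])
    show "bdd_above ((\<lambda>x. INF y\<in>pcarrier U. d x y) ` pcarrier U)"
      using inf_le[OF _ carrier_closed(1)] d01(2)[OF _ carrier_closed(1)]
      by (intro bdd_aboveI[of _ 1]) (force intro: order_trans)
  qed
  then have "(INF y\<in>pcarrier U. d u y) < \<epsilon>" using sup0 \<epsilon> by simp
  moreover have "pcarrier U \<noteq> {}" "bdd_below (d u ` pcarrier U)"
    using u d01(1)[OF u(1)] by (auto intro!: bdd_belowI)
  ultimately have "\<exists>y\<in>pcarrier U. d u y < \<epsilon>"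
    by (simp add: cINF_less_iff)
  then obtain y where y: "y \<in> pcarrier U" "d u y < \<epsilon>" by blast
  have "pmu U (pinter U u y) = prob (A \<inter> ev y)"
    unfolding prob_pinter[OF u(1) y(1)]
    using u y A by (intro finite_measure_eq_AE) auto
  moreover have "pmu U (pinter U u (pcompl U y)) = prob (A - (A \<inter> ev y))"
  proof -
    have "AE x in M. x \<in> ev u \<inter> ev (pcompl U y) \<longleftrightarrow> x \<in> A - (A \<inter> ev y)"
      using u(2) ev_compl[OF y(1)] by eventually_elim auto
    then have "prob (ev u \<inter> ev (pcompl U y)) = prob (A - (A \<inter> ev y))"
      using A u y by (intro finite_measure_eq_AE) auto
    then show ?thesis using u y by (simp add: prob_pinter)
  qed
  ultimately show ?thesis
    using that[of "A \<inter> ev y"] A y by (auto simp: d_def)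
qed

text \<open>Bisection. Halving with error below half of \<open>prob A\<close> leaves both parts with
  at most three quarters of \<open>prob A\<close>, so each round shrinks the error by the factor
  3/4.\<close>

lemma approximate_divisibility:
  assumes "A \<in> events" "0 \<le> r" "r \<le> prob A"
  shows "\<exists>B\<in>events. B \<subseteq> A \<and> \<bar>prob B - r\<bar> \<le> (3/4) ^ k * prob A"
  using assms
proof (induction k arbitrary: A r)
  case 0
  then show ?case by (intro bexI[of _ "{}"]) auto
next
  case (Suc k)
  show ?case
  proof (cases "prob A = 0")
    case True
    then show ?thesis using Suc.prems by (intro bexI[of _ "{}"]) auto
  next
    case False
    then have "prob A / 2 > 0" using zero_less_measure_iff by auto
    with Suc.prems(1) obtain E where E: "E \<in> events" "E \<subseteq> A"
      "\<bar>prob E - prob (A - E)\<bar> < prob A / 2"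
      by (rule almost_halving)
    have sum: "prob A = prob E + prob (A - E)"
      using E Suc.prems finite_measure_Diff[of A E] by simp
    have "prob E \<le> 3/4 * prob A" "prob (A - E) \<le> 3/4 * prob A"
      using E(3) sum by linarith+
    then have "(3/4) ^ k * prob E \<le> (3/4) ^ k * (3/4 * prob A)"
      "(3/4) ^ k * prob (A - E) \<le> (3/4) ^ k * (3/4 * prob A)"
      by (intro mult_left_mono; simp)+
    then have bound: "(3/4) ^ k * prob E \<le> (3/4) ^ Suc k * prob A"
      "(3/4) ^ k * prob (A - E) \<le> (3/4) ^ Suc k * prob A"
      by (simp_all add: mult.assoc mult.left_commute)
    show ?thesis
    \<comment> \<open>If \<open>E\<close> is large enough, the search goes on inside
      \<open>E\<close>; otherwise all of \<open>E\<close> is kept and the missing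
      \<open>r - prob E\<close> is sought in \<open>A - E\<close>.\<close>
    proof (cases "r \<le> prob E")
      case True
      then obtain B where B: "B \<in> events" "B \<subseteq> E" "\<bar>prob B - r\<bar> \<le> (3/4) ^ k * prob E"
        using Suc.IH[of E r] Suc.prems E by auto
      show ?thesis
        by (intro bexI[of _ B] conjI order_trans[OF B(3) bound(1)]) (use B E in auto)
    next
      case False
      then obtain B where B: "B \<in> events" "B \<subseteq> A - E"
        "\<bar>prob B - (r - prob E)\<bar> \<le> (3/4) ^ k * prob (A - E)"
        using Suc.IH[of "A - E" "r - prob E"] Suc.prems E sum by auto
      have "prob (B \<union> E) = prob B + prob E"
        using B E by (intro finite_measure_Union) auto
      then have "\<bar>prob (B \<union> E) - r\<bar> \<le> (3/4) ^ Suc k * prob A"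
        using B(3) bound(2) by linarith
      then show ?thesis by (intro bexI[of _ "B \<union> E"] conjI) (use B E in auto)
    qed
  qed
qed

text \<open>Saturation removes the error: the conditions \<open>\<phi> k\<close> ask for measure
  \<open>r\<close> up to \<open>1 / Suc k\<close>, and finitely many of them follow from the
  strictest one.\<close>

lemma divisibility:
  assumes A: "A \<in> events" and r: "0 \<le> r" "r \<le> prob A"
  obtains B where "B \<in> events" "B \<subseteq> A" "prob B = r"
proof -
  obtain u where u: "u \<in> pcarrier U" "AE x in M. x \<in> ev u \<longleftrightarrow> x \<in> A"
    using A by (rule ev_surj)
  define \<phi> where "\<phi> k = near r (1 / Suc k) (Mu (Meet (Var 0) (Const u)))" for k
  have \<phi>: "fval U (\<phi> k) a = 0 \<longleftrightarrow> \<bar>prob (ev (a 0) \<inter> A) - r\<bar> \<le> 1 / Suc k"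
    if "a 0 \<in> pcarrier U" for a k
  proof -
    have "pmu U (pinter U (a 0) u) = prob (ev (a 0) \<inter> A)"
      unfolding prob_pinter[OF that u(1)]
      using u A that by (intro finite_measure_eq_AE) auto
    then show ?thesis by (simp add: \<phi>_def fval_near)
  qed
  have "\<exists>a. realizes U 1 a \<Gamma>\<^sub>0" if sub: "\<Gamma>\<^sub>0 \<subseteq> range \<phi>" and fin: "finite \<Gamma>\<^sub>0" for \<Gamma>\<^sub>0
  proof -
    obtain K where K: "finite K" "\<Gamma>\<^sub>0 = \<phi> ` K"
      using finite_subset_image[OF fin sub] by auto
    \<comment> \<open>Inserting 0 keeps the maximum meaningful when \<open>K\<close> is
      empty.\<close>
    define N where "N = Max (insert 0 K)"
    obtain m where m: "(3/4 :: real) ^ m < 1 / Suc N"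
      using real_arch_pow_inv[of "1 / Suc N" "3/4"] by auto
    obtain B where B: "B \<in> events" "B \<subseteq> A" "\<bar>prob B - r\<bar> \<le> (3/4) ^ m * prob A"
      using approximate_divisibility[OF A r] by blast
    have "(3/4) ^ m * prob A \<le> (3/4) ^ m * 1"
      by (intro mult_left_mono) auto
    then have B': "\<bar>prob B - r\<bar> \<le> 1 / Suc N" using B m by linarith
    obtain b where b: "b \<in> pcarrier U" "AE x in M. x \<in> ev b \<longleftrightarrow> x \<in> B"
      using B(1) by (rule ev_surj)
    have "AE x in M. x \<in> ev b \<inter> A \<longleftrightarrow> x \<in> B"
      using b(2) by eventually_elim (use B in auto)
    then have "prob (ev b \<inter> A) = prob B"
      using A B b by (intro finite_measure_eq_AE) auto
    moreover have "1 / Suc N \<le> 1 / real (Suc k)" if "k \<in> K" for k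
      using K that by (auto simp: N_def intro!: divide_left_mono)
    ultimately have "realizes U 1 (\<lambda>_. b) \<Gamma>\<^sub>0"
      using K b B' by (fastforce simp: realizes_def \<phi>)
    then show ?thesis by blast
  qed
  moreover have "range \<phi> \<subseteq> formulas {u} 1"
    using r(1) order_trans[OF r(2) prob_le_1] by (auto simp: \<phi>_def intro!: near_formulas) (auto simp: formulas_def)
  ultimately obtain a where real: "realizes U 1 a (range \<phi>)"
    using saturated small_finite[of "{u}"] u unfolding saturated_def
    by (elim allE[of _ "{u}"] allE[of _ "1::nat"] allE[of _ "range \<phi>"]) auto
  then have a0: "a 0 \<in> pcarrier U" by (auto simp: realizes_def)
  have a: "\<bar>prob (ev (a 0) \<inter> A) - r\<bar> \<le> 1 / Suc k" for k
    using real \<phi>[of a] a0 by (auto simp: realizes_def)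
  have "(\<lambda>k. 1 / real (Suc k)) \<longlonglongrightarrow> 0"
    using LIMSEQ_Suc[OF lim_1_over_n] by simp
  then have "\<bar>prob (ev (a 0) \<inter> A) - r\<bar> \<le> 0"
    by (rule LIMSEQ_le_const) (use a in auto)
  then show ?thesis using that[of "ev (a 0) \<inter> A"] a0 A by auto
qed

text \<open>Pieces are cut off one at a time. The bound on the sum guarantees that what remains of
  \<open>R\<close> suffices for the remaining demands.\<close>

lemma disjoint_pieces:
  assumes "finite I" "R \<in> events" "\<And>i. i \<in> I \<Longrightarrow> 0 \<le> \<beta> i" "sum \<beta> I \<le> prob R"
  shows "\<exists>E. (\<forall>i\<in>I. E i \<in> events \<and> E i \<subseteq> R \<and> prob (E i) = \<beta> i) \<and> disjoint_family_on E I"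
  using assms
proof (induction I arbitrary: R rule: finite_induct)
  case empty
  then show ?case by (auto simp: disjoint_family_on_def)
next
  case (insert j I)
  have "0 \<le> sum \<beta> I" using insert.prems by (intro sum_nonneg) auto
  then have "\<beta> j \<le> prob R" using insert by auto
  with insert.prems obtain B where B: "B \<in> events" "B \<subseteq> R" "prob B = \<beta> j"
    using divisibility[of R "\<beta> j"] by auto
  have "sum \<beta> I \<le> prob (R - B)"
    using insert B finite_measure_Diff[of R B] by auto
  with insert.IH[of "R - B"] insert.prems B obtain E
    where E: "\<forall>i\<in>I. E i \<in> events \<and> E i \<subseteq> R - B \<and> prob (E i) = \<beta> i" "disjoint_family_on E I"
    by auto
  show ?case
    by (rule exI[of _ "E(j := B)"])
      (use E B insert.hyps in \<open>auto simp: disjoint_family_on_def; blast\<close>)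
qed

text \<open>
  Keep a part of \<open>A i\<close> of measure \<open>min (prob (A i)) (\<beta> i)\<close>, and
  distribute what is left of \<open>Q\<close> according to the remaining demand \<open>\<beta> i - prob (A i)\<close>.
\<close>

lemma redistribution:
  assumes I: "finite I" and Q: "Q \<in> events"
    and A: "\<And>i. i \<in> I \<Longrightarrow> A i \<in> events" "\<And>i. i \<in> I \<Longrightarrow> A i \<subseteq> Q" "disjoint_family_on A I"
    and \<beta>: "\<And>i. i \<in> I \<Longrightarrow> 0 \<le> \<beta> i" "sum \<beta> I = prob Q"
  shows "\<exists>B. (\<forall>i\<in>I. B i \<in> events \<and> B i \<subseteq> Q \<and> prob (B i) = \<beta> i \<and>
      prob (sym_diff (A i) (B i)) \<le> \<bar>prob (A i) - \<beta> i\<bar>) \<and> disjoint_family_on B I"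
proof -
  define m where "m i = min (prob (A i)) (\<beta> i)" for i
  have "\<forall>i\<in>I. \<exists>B. B \<in> events \<and> B \<subseteq> A i \<and> prob B = m i"
  proof
    fix i assume i: "i \<in> I"
    have "0 \<le> m i" "m i \<le> prob (A i)" using \<beta>(1)[OF i] by (auto simp: m_def)
    with A(1)[OF i] show "\<exists>B. B \<in> events \<and> B \<subseteq> A i \<and> prob B = m i"
      by (rule divisibility) blast
  qed
  then obtain K where K: "\<forall>i\<in>I. K i \<in> events \<and> K i \<subseteq> A i \<and> prob (K i) = m i"
    by metis
  have disjK: "disjoint_family_on K I"
    using A(3) K unfolding disjoint_family_on_def by blast
  define R where "R = Q - (\<Union>i\<in>I. K i)"
  have R: "R \<in> events" using I K Q by (auto simp: R_def)
  have "prob (\<Union>i\<in>I. K i) = (\<Sum>i\<in>I. m i)"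
    using K I disjK by (subst finite_measure_finite_Union) (auto intro!: sum.cong)
  moreover have "(\<Union>i\<in>I. K i) \<subseteq> Q" using K A(2) by blast
  ultimately have "prob R = (\<Sum>i\<in>I. \<beta> i - m i)"
    unfolding R_def using Q I K \<beta>
    by (subst finite_measure_Diff) (auto simp: sum_subtractf)
  \<comment> \<open>The demands add up to \<open>prob R\<close> exactly, and they are nonnegative
    because \<open>m i\<close> is at most \<open>\<beta> i\<close>.\<close>
  then have "\<exists>E. (\<forall>i\<in>I. E i \<in> events \<and> E i \<subseteq> R \<and> prob (E i) = \<beta> i - m i) \<and> disjoint_family_on E I"
    using I R by (intro disjoint_pieces) (auto simp: m_def)
  then obtain E where E: "\<forall>i\<in>I. E i \<in> events \<and> E i \<subseteq> R \<and> prob (E i) = \<beta> i - m i"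
    "disjoint_family_on E I" by blast
  have KE: "K i \<inter> E j = {}" if "i \<in> I" "j \<in> I" for i j
    using that E by (auto simp: R_def)
  have "prob (K i \<union> E i) = \<beta> i" if "i \<in> I" for i
    using that K E KE by (subst finite_measure_Union) auto
  moreover have "prob (sym_diff (A i) (K i \<union> E i)) \<le> \<bar>prob (A i) - \<beta> i\<bar>" if i: "i \<in> I" for i
  proof -
    have ev: "A i \<in> events" "K i \<in> events" "E i \<in> events" "K i \<subseteq> A i"
      "prob (K i) = m i" "prob (E i) = \<beta> i - m i"
      using i A(1) K E(1) by auto
    have "prob (sym_diff (A i) (K i \<union> E i)) \<le> prob ((A i - K i) \<union> E i)"
      using ev by (intro finite_measure_mono) auto
    also have "\<dots> \<le> prob (A i - K i) + prob (E i)"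
      using ev by (intro measure_Un_le) auto
    also have "\<dots> = (prob (A i) - m i) + (\<beta> i - m i)"
      using ev by (simp add: finite_measure_Diff)
    \<comment> \<open>One of the two summands vanishes, because \<open>m i\<close> is a
      minimum.\<close>
    also have "\<dots> = \<bar>prob (A i) - \<beta> i\<bar>" by (auto simp: m_def)
    finally show ?thesis .
  qed
  moreover have "K i \<union> E i \<subseteq> Q" if "i \<in> I" for i
    using that K E A(2) by (force simp: R_def)
  moreover have "disjoint_family_on (\<lambda>i. K i \<union> E i) I"
    using disjK E(2) KE unfolding disjoint_family_on_def by blast
  ultimately show ?thesis
    using K E by (intro exI[of _ "\<lambda>i. K i \<union> E i"]) auto
qed

text \<open>The redistributions carried out in the single cells are glued together. The events
  \<open>G i\<close> enter only through their measures in the cells, so they may overlap in null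
  sets, whereas the \<open>A i\<close> are disjoint as sets.\<close>

lemma redistribution_cells:
  assumes I: "finite I" and J: "finite J"
    and Q: "\<And>j. j \<in> J \<Longrightarrow> Q j \<in> events" "disjoint_family_on Q J" "(\<Union>j\<in>J. Q j) = space M"
    and A: "\<And>i. i \<in> I \<Longrightarrow> A i \<in> events" "disjoint_family_on A I"
    and G: "\<And>i. i \<in> I \<Longrightarrow> G i \<in> events" "\<And>j. j \<in> J \<Longrightarrow> (\<Sum>i\<in>I. prob (G i \<inter> Q j)) = prob (Q j)"
  obtains B where "\<And>i. i \<in> I \<Longrightarrow> B i \<in> events" "disjoint_family_on B I"
    "\<And>i j. i \<in> I \<Longrightarrow> j \<in> J \<Longrightarrow> prob (B i \<inter> Q j) = prob (G i \<inter> Q j)"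
    "\<And>i. i \<in> I \<Longrightarrow> prob (sym_diff (A i) (B i)) \<le> (\<Sum>j\<in>J. \<bar>prob (A i \<inter> Q j) - prob (G i \<inter> Q j)\<bar>)"
proof -
  have "\<forall>j\<in>J. \<exists>B. (\<forall>i\<in>I. B i \<in> events \<and> B i \<subseteq> Q j \<and> prob (B i) = prob (G i \<inter> Q j) \<and>
      prob (sym_diff (A i \<inter> Q j) (B i)) \<le> \<bar>prob (A i \<inter> Q j) - prob (G i \<inter> Q j)\<bar>) \<and>
      disjoint_family_on B I"
  proof
    fix j assume j: "j \<in> J"
    have "disjoint_family_on (\<lambda>i. A i \<inter> Q j) I"
      using A(2) by (fastforce simp: disjoint_family_on_def)
    then show "\<exists>B. (\<forall>i\<in>I. B i \<in> events \<and> B i \<subseteq> Q j \<and> prob (B i) = prob (G i \<inter> Q j) \<and>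
      prob (sym_diff (A i \<inter> Q j) (B i)) \<le> \<bar>prob (A i \<inter> Q j) - prob (G i \<inter> Q j)\<bar>) \<and>
      disjoint_family_on B I"
      using j I Q A G by (intro redistribution) auto
  qed
  then obtain B where B: "\<And>j i. j \<in> J \<Longrightarrow> i \<in> I \<Longrightarrow> B j i \<in> events \<and> B j i \<subseteq> Q j \<and>
      prob (B j i) = prob (G i \<inter> Q j) \<and>
      prob (sym_diff (A i \<inter> Q j) (B j i)) \<le> \<bar>prob (A i \<inter> Q j) - prob (G i \<inter> Q j)\<bar>"
    and disjB: "\<And>j. j \<in> J \<Longrightarrow> disjoint_family_on (B j) I"
    by metis
  define B' where "B' i = (\<Union>j\<in>J. B j i)" for i
  \<comment> \<open>Disjointness of the cells makes every local piece recoverable from the glued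
    set; measures and disjointness can then be checked cell by cell.\<close>
  have cell: "B' i \<inter> Q j = B j i" if "i \<in> I" "j \<in> J" for i j
  proof -
    have "B k i \<inter> Q j = {}" if "k \<in> J" "k \<noteq> j" for k
    proof -
      have "Q k \<inter> Q j = {}" "B k i \<subseteq> Q k"
        using Q(2) B[of k i] that \<open>i \<in> I\<close> \<open>j \<in> J\<close> by (auto simp: disjoint_family_on_def)
      then show ?thesis by blast
    qed
    moreover have "B j i \<subseteq> Q j" using B that by auto
    ultimately show ?thesis unfolding B'_def using that by blast
  qed
  show ?thesis
  proof
    show ev: "B' i \<in> events" if "i \<in> I" for i
      using B J that by (auto simp: B'_def)
    show "prob (B' i \<inter> Q j) = prob (G i \<inter> Q j)" if "i \<in> I" "j \<in> J" for i j
      using B that by (simp add: cell)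
    show "disjoint_family_on B' I"
      unfolding disjoint_family_on_def
    proof (intro ballI impI)
      fix i k assume ik: "i \<in> I" "k \<in> I" "i \<noteq> k"
      have "B' i \<inter> B' k \<inter> Q j = {}" if "j \<in> J" for j
      proof -
        have "B' i \<inter> B' k \<inter> Q j = B j i \<inter> B j k"
          using cell[OF ik(1) that] cell[OF ik(2) that] by blast
        then show ?thesis using disjB[OF that] ik by (auto simp: disjoint_family_on_def)
      qed
      moreover have "B' i \<subseteq> space M" using ev[OF ik(1)] by (rule sets.sets_into_space)
      ultimately show "B' i \<inter> B' k = {}" using Q(3) by blast
    qed
    show "prob (sym_diff (A i) (B' i)) \<le> (\<Sum>j\<in>J. \<bar>prob (A i \<inter> Q j) - prob (G i \<inter> Q j)\<bar>)"
      if i: "i \<in> I" for i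
    proof -
      have "sym_diff (A i) (B' i) \<subseteq> space M"
        using ev[OF i] A(1)[OF i] sets.sets_into_space by blast
      then have sub: "sym_diff (A i) (B' i) \<subseteq> (\<Union>j\<in>J. sym_diff (A i \<inter> Q j) (B j i))"
        using Q(3) cell[OF i] by blast
      have evs: "sym_diff (A i \<inter> Q j) (B j i) \<in> events" if "j \<in> J" for j
        using A(1)[OF i] Q(1)[OF that] B[OF that i] by auto
      have "prob (sym_diff (A i) (B' i)) \<le> prob (\<Union>j\<in>J. sym_diff (A i \<inter> Q j) (B j i))"
        using sub evs J by (intro finite_measure_mono sets.finite_UN) auto
      also have "\<dots> \<le> (\<Sum>j\<in>J. prob (sym_diff (A i \<inter> Q j) (B j i)))"
        using J evs by (intro finite_measure_subadditive_finite) auto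
      also have "\<dots> \<le> (\<Sum>j\<in>J. \<bar>prob (A i \<inter> Q j) - prob (G i \<inter> Q j)\<bar>)"
        using B i by (intro sum_mono) auto
      finally show ?thesis .
    qed
  qed
qed

end

section \<open>Quantifier elimination\<close>

text \<open>Evaluation in the two-element Boolean algebra, where exactly the atomic terms in
  \<open>J\<close> are true.\<close>

primrec tm_holds :: "'c tm \<Rightarrow> 'c tm set \<Rightarrow> bool" where
  "tm_holds (Var i) J \<longleftrightarrow> Var i \<in> J"
| "tm_holds (Const c) J \<longleftrightarrow> Const c \<in> J"
| "tm_holds TZero J \<longleftrightarrow> False"
| "tm_holds TOne J \<longleftrightarrow> True"
| "tm_holds (Cpl t) J \<longleftrightarrow> \<not> tm_holds t J"
| "tm_holds (Meet s t) J \<longleftrightarrow> tm_holds s J \<and> tm_holds t J"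
| "tm_holds (Join s t) J \<longleftrightarrow> tm_holds s J \<or> tm_holds t J"

lemma tval_cong: "(\<And>i. i \<in> tvars t \<Longrightarrow> v i = w i) \<Longrightarrow> tval U t v = tval U t w"
  by (induction t) auto

lemma finite_tconsts: "finite (tconsts t)"
  by (induction t) auto

lemma finite_fconsts: "finite (fconsts \<phi>)"
  by (induction \<phi>) (auto simp: finite_tconsts)

section \<open>Joint distributions of finitely many named events\<close>

context represented_structure
begin

text \<open>\<open>I\<close> is a set of atomic terms, and \<open>pattern I v x\<close> is the cell containing \<open>x\<close> of the
  finite algebra generated by their values.\<close>

definition pattern :: "'a tm set \<Rightarrow> (nat \<Rightarrow> 'a) \<Rightarrow> 'x \<Rightarrow> 'a tm set" where
  "pattern I v x = {t \<in> I. x \<in> ev (tval U t v)}"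

definition cell :: "'a tm set \<Rightarrow> (nat \<Rightarrow> 'a) \<Rightarrow> 'a tm set \<Rightarrow> 'x set" where
  "cell I v J = {x \<in> space M. pattern I v x = J}"

text \<open>Assignments are total functions, so membership in the carrier is demanded only at the
  variables and constants that \<open>I\<close> mentions.\<close>

definition admissible :: "'a tm set \<Rightarrow> (nat \<Rightarrow> 'a) \<Rightarrow> bool" where
  "admissible I v \<longleftrightarrow> finite I \<and> I \<subseteq> range Var \<union> range Const \<and> (\<forall>t\<in>I. tval U t v \<in> pcarrier U)"

text \<open>Equality of the joint distributions of the events named by \<open>I\<close>. This is the
  invariant of the back-and-forth argument.\<close>

definition similar :: "'a tm set \<Rightarrow> (nat \<Rightarrow> 'a) \<Rightarrow> (nat \<Rightarrow> 'a) \<Rightarrow> bool" where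
  "similar I v w \<longleftrightarrow> (\<forall>J. prob (cell I v J) = prob (cell I w J))"

lemma tval_carrier:
  assumes "admissible I v" "Var ` tvars t \<union> Const ` tconsts t \<subseteq> I"
  shows "tval U t v \<in> pcarrier U"
  using assms(2)
proof (induction t)
  case (Var i)
  then have "Var i \<in> I" by auto
  then show ?case using assms(1) unfolding admissible_def by fastforce
next
  case (Const c)
  then have "Const c \<in> I" by auto
  then show ?case using assms(1) unfolding admissible_def by fastforce
qed auto

text \<open>Up to a null set, the event of a term is a union of cells: its truth at a point depends
  only on the pattern there, by induction on the term.\<close>

lemma ev_tval:
  assumes "admissible I v" "Var ` tvars t \<union> Const ` tconsts t \<subseteq> I"
  shows "AE x in M. x \<in> ev (tval U t v) \<longleftrightarrow> tm_holds t (pattern I v x)"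
  using assms(2)
proof (induction t)
  case TZero
  then show ?case using ev_zero by simp
next
  case TOne
  then show ?case using ev_one by simp
next
  case (Cpl t)
  then have "tval U t v \<in> pcarrier U" using tval_carrier[OF assms(1)] by auto
  then have "AE x in M. x \<in> ev (tval U (Cpl t) v) \<longleftrightarrow> x \<notin> ev (tval U t v)"
    by (simp add: ev_compl)
  moreover have "AE x in M. x \<in> ev (tval U t v) \<longleftrightarrow> tm_holds t (pattern I v x)"
    using Cpl by auto
  ultimately show ?case by eventually_elim simp
next
  case (Meet s t)
  then have "tval U s v \<in> pcarrier U" "tval U t v \<in> pcarrier U"
    using tval_carrier[OF assms(1)] by (auto simp: image_Un)
  then have "AE x in M. x \<in> ev (tval U (Meet s t) v) \<longleftrightarrow> x \<in> ev (tval U s v) \<and> x \<in> ev (tval U t v)"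
    by (simp add: ev_inter)
  moreover have "AE x in M. x \<in> ev (tval U s v) \<longleftrightarrow> tm_holds s (pattern I v x)"
    "AE x in M. x \<in> ev (tval U t v) \<longleftrightarrow> tm_holds t (pattern I v x)"
    using Meet by (auto simp: image_Un)
  ultimately show ?case by eventually_elim simp
next
  case (Join s t)
  then have "tval U s v \<in> pcarrier U" "tval U t v \<in> pcarrier U"
    using tval_carrier[OF assms(1)] by (auto simp: image_Un)
  then have "AE x in M. x \<in> ev (tval U (Join s t) v) \<longleftrightarrow> x \<in> ev (tval U s v) \<or> x \<in> ev (tval U t v)"
    by (simp add: ev_union)
  moreover have "AE x in M. x \<in> ev (tval U s v) \<longleftrightarrow> tm_holds s (pattern I v x)"
    "AE x in M. x \<in> ev (tval U t v) \<longleftrightarrow> tm_holds t (pattern I v x)"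
    using Join by (auto simp: image_Un)
  ultimately show ?case by eventually_elim simp
qed (auto simp: pattern_def)

text \<open>The sigma-algebra is a parameter because cells are needed both as events and as members
  of the sigma-algebra belonging to \<open>C\<close>.\<close>

lemma cell_in_sigma_algebra:
  assumes N: "sigma_algebra (space M) N" and I: "finite I" "\<And>t. t \<in> I \<Longrightarrow> ev (tval U t v) \<in> N"
  shows "cell I v J \<in> N"
proof -
  interpret N: sigma_algebra "space M" N by fact
  show ?thesis
  proof (cases "J \<subseteq> I")
    case True
    have "cell I v J = {x \<in> space M. \<forall>t\<in>I. x \<in> ev (tval U t v) \<longleftrightarrow> t \<in> J}"
      using True by (auto simp: cell_def pattern_def)
    also have "\<dots> \<in> N"
    proof (rule N.sets_Collect_finite_All[OF _ I(1)])
      fix t assume t: "t \<in> I"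
      have "{x \<in> space M. x \<in> ev (tval U t v) \<longleftrightarrow> t \<in> J} =
          (if t \<in> J then ev (tval U t v) \<inter> space M else space M - ev (tval U t v))"
        by auto
      then show "{x \<in> space M. x \<in> ev (tval U t v) \<longleftrightarrow> t \<in> J} \<in> N"
        using I(2)[OF t] by auto
    qed
    finally show ?thesis .
  next
    case False
    then have "cell I v J = {}" by (auto simp: cell_def pattern_def)
    then show ?thesis by simp
  qed
qed

lemma cell_events: "admissible I v \<Longrightarrow> cell I v J \<in> events"
  by (rule cell_in_sigma_algebra) (auto simp: sets.sigma_algebra_axioms admissible_def)

lemma disjoint_cells: "disjoint_family_on (cell I v) \<J>"
  by (auto simp: disjoint_family_on_def cell_def)

lemma pattern_subset: "pattern I v x \<subseteq> I"
  by (auto simp: pattern_def)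

lemma Un_cells: "(\<Union>J\<in>Pow I. cell I v J) = space M"
proof -
  have "x \<in> (\<Union>J\<in>Pow I. cell I v J)" if "x \<in> space M" for x
    by (rule UN_I[of "pattern I v x"]) (use that pattern_subset in \<open>auto simp: cell_def\<close>)
  then show ?thesis by (auto simp: cell_def)
qed

text \<open>A property of the pattern cuts out a finite disjoint union of cells. The event
  \<open>E\<close> is arbitrary so that the sum formula also applies inside the members of a
  partition.\<close>

lemma prob_cells:
  assumes v: "admissible I v" and E: "E \<in> events"
  shows "{x \<in> E. P (pattern I v x)} \<in> events"
    "prob {x \<in> E. P (pattern I v x)} = (\<Sum>J | J \<subseteq> I \<and> P J. prob (E \<inter> cell I v J))"
proof -
  have fin: "finite {J. J \<subseteq> I \<and> P J}" using v by (auto simp: admissible_def)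
  have eq: "{x \<in> E. P (pattern I v x)} = (\<Union>J\<in>{J. J \<subseteq> I \<and> P J}. E \<inter> cell I v J)"
    using sets.sets_into_space[OF E] pattern_subset by (auto simp: cell_def)
  have "(\<Union>J\<in>{J. J \<subseteq> I \<and> P J}. E \<inter> cell I v J) \<in> events"
    using fin E cell_events[OF v] by (intro sets.finite_UN) auto
  then show "{x \<in> E. P (pattern I v x)} \<in> events" unfolding eq .
  show "prob {x \<in> E. P (pattern I v x)} = (\<Sum>J | J \<subseteq> I \<and> P J. prob (E \<inter> cell I v J))"
    unfolding eq using fin E cell_events[OF v]
    by (intro finite_measure_finite_Union) (auto simp: disjoint_family_on_def cell_def)
qed

lemma similar_prob:
  assumes "similar I v w" "admissible I v" "admissible I w"
  shows "prob {x \<in> space M. P (pattern I v x)} = prob {x \<in> space M. P (pattern I w x)}"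
proof -
  have "space M \<inter> cell I u J = cell I u J" for u J by (auto simp: cell_def)
  then show ?thesis
    using assms by (simp add: prob_cells(2)[OF _ sets.top] similar_def)
qed

text \<open>A cell for the smaller set of terms is a union of cells for the larger one.\<close>

lemma similar_mono:
  assumes "similar I v w" "admissible I v" "admissible I w" "K \<subseteq> I"
  shows "similar K v w"
  unfolding similar_def
proof
  fix J
  have "cell K u J = {x \<in> space M. pattern I u x \<inter> K = J}" for u
    using assms(4) by (auto simp: cell_def pattern_def)
  then show "prob (cell K v J) = prob (cell K w J)"
    using similar_prob[OF assms(1-3), of "\<lambda>L. L \<inter> K = J"] by simp
qed

lemma similar_sym: "similar I v w \<Longrightarrow> similar I w v"
  by (simp add: similar_def)

lemma tval_fun_upd:
  assumes "t \<in> range Var \<union> range Const" "t \<noteq> Var i"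
  shows "tval U t (v(i := x)) = tval U t v"
  using assms by (auto split: if_splits)

lemma admissible_upd:
  assumes "admissible I v" "Var i \<notin> I" "x \<in> pcarrier U"
  shows "admissible (insert (Var i) I) (v(i := x))"
  unfolding admissible_def
proof (intro conjI ballI)
  fix t assume t: "t \<in> insert (Var i) I"
  show "tval U t (v(i := x)) \<in> pcarrier U"
  proof (cases "t = Var i")
    case True
    then show ?thesis using assms(3) by simp
  next
    case False
    then have "tval U t (v(i := x)) = tval U t v" "tval U t v \<in> pcarrier U"
      using t assms(1) by (auto intro!: tval_fun_upd simp: admissible_def)
    then show ?thesis by simp
  qed
qed (use assms in \<open>auto simp: admissible_def\<close>)

text \<open>A new event splits each old cell into an inner and an outer part. As
  \<open>Var i\<close> is not in \<open>I\<close>, overwriting \<open>v\<close> at \<open>i\<close>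
  does not disturb the old cells.\<close>

lemma cell_upd:
  assumes v: "admissible I v" "Var i \<notin> I" "x \<in> pcarrier U"
  shows "cell (insert (Var i) I) (v(i := x)) J =
    (if J \<subseteq> insert (Var i) I then
      if Var i \<in> J then cell I v (J - {Var i}) \<inter> ev x else cell I v J - ev x
    else {})"
proof -
  have "pattern (insert (Var i) I) (v(i := x)) z =
      pattern I v z \<union> (if z \<in> ev x then {Var i} else {})" for z
  proof -
    have "tval U t (v(i := x)) = tval U t v" if "t \<in> I" for t
      using that v by (intro tval_fun_upd) (auto simp: admissible_def)
    then show ?thesis by (auto simp: pattern_def)
  qed
  moreover have "pattern I v z \<subseteq> I" for z by (rule pattern_subset)
  ultimately show ?thesis using v(2) unfolding cell_def by auto
qed

end

section \<open>The back-and-forth argument\<close>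

context apa_domain
begin

text \<open>Divisibility provides, in each cell of \<open>w\<close>, a piece as large as the part of
  the corresponding cell of \<open>v\<close> lying in \<open>x\<close>. The union of these pieces
  represents \<open>y\<close>.\<close>

lemma similar_extend:
  assumes sim: "similar I v w" and v: "admissible I v" and w: "admissible I w"
    and i: "Var i \<notin> I" and x: "x \<in> pcarrier U"
  obtains y where "y \<in> pcarrier U" "similar (insert (Var i) I) (v(i := x)) (w(i := y))"
proof -
  have "\<forall>J. \<exists>B. B \<in> events \<and> B \<subseteq> cell I w J \<and> prob B = prob (cell I v J \<inter> ev x)"
  proof
    fix J
    have "prob (cell I v J \<inter> ev x) \<le> prob (cell I w J)"
      using finite_measure_mono[of "cell I v J \<inter> ev x" "cell I v J"] cell_events[OF v, of J] sim
      by (simp add: similar_def)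
    with cell_events[OF w] measure_nonneg
    show "\<exists>B. B \<in> events \<and> B \<subseteq> cell I w J \<and> prob B = prob (cell I v J \<inter> ev x)"
      by (rule divisibility) blast
  qed
  then obtain B where B: "\<And>J. B J \<in> events" "\<And>J. B J \<subseteq> cell I w J"
    "\<And>J. prob (B J) = prob (cell I v J \<inter> ev x)" by metis
  have fin: "finite (Pow I)" using v by (simp add: admissible_def)
  define D where "D = (\<Union>J\<in>Pow I. B J)"
  have D: "D \<in> events" using fin B unfolding D_def by (intro sets.finite_UN) auto
  then obtain y where y: "y \<in> pcarrier U" "AE x in M. x \<in> ev y \<longleftrightarrow> x \<in> D"
    by (rule ev_surj)
  have pD: "prob (cell I w J \<inter> ev y) = prob (cell I v J \<inter> ev x)" if J: "J \<subseteq> I" for J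
  proof -
    have "cell I w J \<inter> D = B J"
      using B(2) J unfolding D_def by (fastforce simp: cell_def)
    then have "AE x in M. x \<in> cell I w J \<inter> ev y \<longleftrightarrow> x \<in> B J"
      using y(2) by (auto elim!: eventually_mono)
    then have "prob (cell I w J \<inter> ev y) = prob (B J)"
      using B(1) cell_events[OF w] y by (intro finite_measure_eq_AE) auto
    then show ?thesis using B(3) by simp
  qed
  have "similar (insert (Var i) I) (v(i := x)) (w(i := y))"
    unfolding similar_def
  proof
    fix J
    \<comment> \<open>The outer parts agree by subtraction, since the whole cells have equal
      measure.\<close>
    have "prob (cell I v J - ev x) = prob (cell I w J - ev y)" if "J \<subseteq> I"
      using pD[OF that] sim cell_events[OF v] cell_events[OF w] x y
      by (simp add: finite_measure_Diff' similar_def)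
    moreover have "J - {Var i} \<subseteq> I" if "J \<subseteq> insert (Var i) I"
      using that by auto
    ultimately show "prob (cell (insert (Var i) I) (v(i := x)) J) = prob (cell (insert (Var i) I) (w(i := y)) J)"
      using pD[of "J - {Var i}"]
      by (simp add: cell_upd[OF v i x] cell_upd[OF w i y(1)] subset_insert)
  qed
  with y(1) show ?thesis by (rule that)
qed

text \<open>Every witness on one side is matched on the other. Equality of the sets of values
  settles suprema and infima at once.\<close>

lemma quantifier_range:
  assumes IH: "\<And>I v w. admissible I v \<Longrightarrow> admissible I w \<Longrightarrow> similar I v w \<Longrightarrow>
      Var ` fvars \<phi> \<union> Const ` fconsts \<phi> \<subseteq> I \<Longrightarrow> fval U \<phi> v = fval U \<phi> w"
    and v: "admissible I v" and w: "admissible I w" and sim: "similar I v w"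
    and I: "Var ` (fvars \<phi> - {i}) \<union> Const ` fconsts \<phi> \<subseteq> I"
  shows "(\<lambda>x. fval U \<phi> (v(i := x))) ` pcarrier U = (\<lambda>x. fval U \<phi> (w(i := x))) ` pcarrier U"
proof -
  \<comment> \<open>The old value of the quantified variable is forgotten before the new one is
    added.\<close>
  define K where "K = I - {Var i}"
  have nK: "Var i \<notin> K" by (simp add: K_def)
  have IK: "Var ` fvars \<phi> \<union> Const ` fconsts \<phi> \<subseteq> insert (Var i) K"
    using I by (auto simp: K_def)
  have adm: "admissible K u" if "admissible I u" for u
    using that by (auto simp: K_def admissible_def)
  have sub: "(\<lambda>x. fval U \<phi> (v(i := x))) ` pcarrier U \<subseteq> (\<lambda>x. fval U \<phi> (w(i := x))) ` pcarrier U"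
    if vw: "admissible I v" "admissible I w" "similar I v w" for v w
  proof
    fix r assume "r \<in> (\<lambda>x. fval U \<phi> (v(i := x))) ` pcarrier U"
    then obtain x where x: "x \<in> pcarrier U" "r = fval U \<phi> (v(i := x))" by auto
    have sim: "similar K v w" by (rule similar_mono[OF vw(3,1,2)]) (auto simp: K_def)
    obtain y where y: "y \<in> pcarrier U" "similar (insert (Var i) K) (v(i := x)) (w(i := y))"
      by (rule similar_extend[OF sim adm[OF vw(1)] adm[OF vw(2)] nK x(1)])
    have "fval U \<phi> (v(i := x)) = fval U \<phi> (w(i := y))"
      by (rule IH[OF admissible_upd[OF adm[OF vw(1)] nK x(1)]
            admissible_upd[OF adm[OF vw(2)] nK y(1)] y(2) IK])
    then show "r \<in> (\<lambda>x. fval U \<phi> (w(i := x))) ` pcarrier U" using x y by auto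
  qed
  show ?thesis
    using sub[OF v w sim] sub[OF w v similar_sym[OF sim]] by (rule subset_antisym)
qed

text \<open>Quantifier elimination in semantic form. Atomic formulas are probabilities of unions of
  cells, and the quantifier cases use \<open>quantifier_range\<close>; these change both the terms
  and the assignments, hence the generalization over \<open>I\<close>, \<open>v\<close> and
  \<open>w\<close>.\<close>

lemma fval_similar:
  assumes "admissible I v" "admissible I w" "similar I v w"
    "Var ` fvars \<phi> \<union> Const ` fconsts \<phi> \<subseteq> I"
  shows "fval U \<phi> v = fval U \<phi> w"
  using assms
proof (induction \<phi> arbitrary: I v w)
  case (Mu t)
  have "prob (ev (tval U t u)) = prob {x \<in> space M. tm_holds t (pattern I u x)}"
    if "admissible I u" for u
    using ev_tval[OF that] tval_carrier[OF that] Mu prob_cells(1)[OF that sets.top] AE_space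
    by (intro finite_measure_eq_AE) auto
  then show ?case
    using Mu similar_prob[of I v w] tval_carrier[of I _ t] by (simp add: pmu_ev)
next
  case (Dist s t)
  have "prob (sym_diff (ev (tval U s u)) (ev (tval U t u))) =
      prob {x \<in> space M. tm_holds s (pattern I u x) \<noteq> tm_holds t (pattern I u x)}"
    if u: "admissible I u" for u
  proof (rule finite_measure_eq_AE)
    have *: "Var ` tvars s \<union> Const ` tconsts s \<subseteq> I" "Var ` tvars t \<union> Const ` tconsts t \<subseteq> I"
      using Dist.prems by auto
    show "AE x in M. x \<in> sym_diff (ev (tval U s u)) (ev (tval U t u)) \<longleftrightarrow>
        x \<in> {x \<in> space M. tm_holds s (pattern I u x) \<noteq> tm_holds t (pattern I u x)}"
      using ev_tval[OF u *(1)] ev_tval[OF u *(2)] AE_space by eventually_elim auto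
    show "{x \<in> space M. tm_holds s (pattern I u x) \<noteq> tm_holds t (pattern I u x)} \<in> events"
      using prob_cells(1)[OF u sets.top] by simp
    show "sym_diff (ev (tval U s u)) (ev (tval U t u)) \<in> events"
      using tval_carrier[OF u *(1)] tval_carrier[OF u *(2)] by auto
  qed
  then show ?case
    using Dist similar_prob[of I v w] tval_carrier[of I _ t] tval_carrier[of I _ s]
    by (simp add: pdist_ev image_Un)
next
  case (Conn u \<phi>s)
  have "map (\<lambda>\<phi>. fval U \<phi> v) \<phi>s = map (\<lambda>\<phi>. fval U \<phi> w) \<phi>s"
  proof (rule map_cong[OF refl])
    fix \<phi> assume \<phi>: "\<phi> \<in> set \<phi>s"
    then have "fvars \<phi> \<subseteq> fvars (Conn u \<phi>s)" "fconsts \<phi> \<subseteq> fconsts (Conn u \<phi>s)"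
      by auto
    then have "Var ` fvars \<phi> \<union> Const ` fconsts \<phi> \<subseteq> I"
      using Conn.prems(4) by blast
    with \<phi> Conn.prems(1-3) show "fval U \<phi> v = fval U \<phi> w"
      by (rule Conn.IH)
  qed
  then show ?case by (simp only: fval.simps)
next
  case (SupQ i \<phi>)
  have "Var ` (fvars \<phi> - {i}) \<union> Const ` fconsts \<phi> \<subseteq> I"
    using SupQ.prems(4) by (simp only: fvars.simps fm.set)
  with SupQ.IH SupQ.prems(1-3)
  have "(\<lambda>x. fval U \<phi> (v(i := x))) ` pcarrier U = (\<lambda>x. fval U \<phi> (w(i := x))) ` pcarrier U"
    by (rule quantifier_range)
  then show ?case by simp
next
  case (InfQ i \<phi>)
  have "Var ` (fvars \<phi> - {i}) \<union> Const ` fconsts \<phi> \<subseteq> I"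
    using InfQ.prems(4) by (simp only: fvars.simps fm.set)
  with InfQ.IH InfQ.prems(1-3)
  have "(\<lambda>x. fval U \<phi> (v(i := x))) ` pcarrier U = (\<lambda>x. fval U \<phi> (w(i := x))) ` pcarrier U"
    by (rule quantifier_range)
  then show ?case by simp
qed

end

section \<open>Conditional probabilities\<close>

text \<open>Names for the elements of the Boolean algebra generated by \<open>C\<close>.\<close>

definition closed_terms :: "'c set \<Rightarrow> 'c tm set" where
  "closed_terms C = {t. tconsts t \<subseteq> C \<and> tvars t = {}}"

lemma closed_terms_intros:
  "c \<in> C \<Longrightarrow> Const c \<in> closed_terms C" "TZero \<in> closed_terms C" "TOne \<in> closed_terms C"
  "s \<in> closed_terms C \<Longrightarrow> t \<in> closed_terms C \<Longrightarrow> Meet s t \<in> closed_terms C"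
  by (auto simp: closed_terms_def)

section \<open>The sigma-algebra generated by the events of \<open>C\<close>\<close>

context represented_structure
begin

text \<open>The constant assignment is a dummy, as the terms of interest have no variables.\<close>

definition cev :: "'a tm \<Rightarrow> 'x set" where
  "cev t = ev (tval U t (\<lambda>_. pzero U))"

lemma ev_closed_term: "t \<in> closed_terms C \<Longrightarrow> ev (tval U t v) = cev t"
  unfolding cev_def by (intro arg_cong[of _ _ ev] tval_cong) (auto simp: closed_terms_def)

lemma closed_term_carrier:
  assumes "C \<subseteq> pcarrier U" "t \<in> closed_terms C"
  shows "tval U t v \<in> pcarrier U"
proof (rule tval_carrier)
  show "admissible (Const ` tconsts t) v"
    using assms by (auto simp: admissible_def finite_tconsts closed_terms_def)
qed (use assms in \<open>auto simp: closed_terms_def\<close>)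

lemma cev_events:
  assumes "C \<subseteq> pcarrier U" "t \<in> closed_terms C"
  shows "cev t \<in> events"
  unfolding cev_def by (intro ev_events closed_term_carrier[OF assms])

text \<open>The Boolean algebra generated by \<open>C\<close>, closed under changes on null sets.
  The closure is needed because \<open>corr_sigma\<close> contains all members of a class.\<close>

definition term_events :: "'a set \<Rightarrow> 'x set set" where
  "term_events C = {A \<in> events. \<exists>t\<in>closed_terms C. AE x in M. x \<in> A \<longleftrightarrow> x \<in> cev t}"

lemma Int_stable_term_events:
  assumes C: "C \<subseteq> pcarrier U"
  shows "Int_stable (term_events C)"
  unfolding Int_stable_def
proof (intro ballI)
  fix A B assume "A \<in> term_events C" "B \<in> term_events C"
  then obtain s t where s: "A \<in> events" "s \<in> closed_terms C" "AE x in M. x \<in> A \<longleftrightarrow> x \<in> cev s"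
    and t: "B \<in> events" "t \<in> closed_terms C" "AE x in M. x \<in> B \<longleftrightarrow> x \<in> cev t"
    by (auto simp: term_events_def)
  have "AE x in M. x \<in> cev (Meet s t) \<longleftrightarrow> x \<in> cev s \<and> x \<in> cev t"
    using closed_term_carrier[OF C s(2)] closed_term_carrier[OF C t(2)]
    by (simp add: cev_def ev_inter)
  then have "AE x in M. x \<in> A \<inter> B \<longleftrightarrow> x \<in> cev (Meet s t)"
    using s(3) t(3) by eventually_elim auto
  then show "A \<inter> B \<in> term_events C"
    using s t closed_terms_intros(4) by (auto simp: term_events_def)
qed

lemma null_term_events:
  assumes "A \<in> events" "AE x in M. x \<notin> A"
  shows "A \<in> term_events C"
proof -
  have "AE x in M. x \<in> A \<longleftrightarrow> x \<in> cev TZero"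
    using assms(2) ev_zero unfolding cev_def tval.simps by eventually_elim auto
  then show ?thesis using assms(1) closed_terms_intros(2) by (auto simp: term_events_def)
qed

text \<open>\<open>A\<close> arises from \<open>B\<close> by removing one null event and adding
  another, and null events are among the generators.\<close>

lemma sigma_term_events_AE:
  assumes B: "B \<in> sigma_sets (space M) (term_events C)" "B \<in> events"
    and A: "A \<in> events" "AE x in M. x \<in> A \<longleftrightarrow> x \<in> B"
  shows "A \<in> sigma_sets (space M) (term_events C)"
proof -
  interpret sigma_algebra "space M" "sigma_sets (space M) (term_events C)"
    by (rule sigma_algebra_sigma_sets) (auto simp: term_events_def dest: sets.sets_into_space)
  have "AE x in M. x \<notin> B - A" "AE x in M. x \<notin> A - B"
    using A(2) by (eventually_elim, auto)+
  then have "B - A \<in> term_events C" "A - B \<in> term_events C"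
    using A B by (auto intro!: null_term_events)
  then have "B - (B - A) \<union> (A - B) \<in> sigma_sets (space M) (term_events C)"
    by (intro Un Diff B(1) sigma_sets.Basic)
  also have "B - (B - A) \<union> (A - B) = A" by auto
  finally show ?thesis .
qed

text \<open>The elements with representatives in the generated sigma-algebra form a sigma-subalgebra
  containing \<open>C\<close>, so minimality of the hull applies.\<close>

lemma gen_sigma_term_events:
  assumes C: "C \<subseteq> pcarrier U"
  shows "gen U C \<subseteq> {u \<in> pcarrier U. ev u \<in> sigma_sets (space M) (term_events C)}"
    (is "_ \<subseteq> ?T")
  unfolding gen_def
proof (rule hull_minimal)
  interpret sigma_algebra "space M" "sigma_sets (space M) (term_events C)"
    by (rule sigma_algebra_sigma_sets) (auto simp: term_events_def dest: sets.sets_into_space)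
  \<comment> \<open>The representative of a Boolean combination agrees with the set operation only
    almost everywhere; this rule absorbs the difference.\<close>
  have AE_I: "v \<in> ?T" if "B \<in> sigma_sets (space M) (term_events C)" "B \<in> events"
    "v \<in> pcarrier U" "AE x in M. x \<in> ev v \<longleftrightarrow> x \<in> B" for v B
    using sigma_term_events_AE[OF that(1,2) ev_events[OF that(3)] that(4)] that(3) by simp
  show "C \<subseteq> ?T"
  proof
    fix c assume c: "c \<in> C"
    then have "ev c = cev (Const c)" by (simp add: cev_def)
    then have "ev c \<in> term_events C"
      using cev_events[OF C closed_terms_intros(1)[OF c]] closed_terms_intros(1)[OF c]
      by (auto simp: term_events_def)
    then show "c \<in> ?T" using c C by auto
  qed
  have zero: "pzero U \<in> ?T"
    by (rule AE_I[of "{}"]) (use ev_zero in auto)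
  have "AE x in M. x \<in> ev (pone U) \<longleftrightarrow> x \<in> space M"
    using ev_one AE_space by eventually_elim auto
  then have one: "pone U \<in> ?T"
    by (rule AE_I[of "space M", rotated 3]) auto
  have compl: "pcompl U u \<in> ?T" if "u \<in> ?T" for u
  proof (rule AE_I)
    have u: "u \<in> pcarrier U" "ev u \<in> sigma_sets (space M) (term_events C)" using that by auto
    show "space M - ev u \<in> sigma_sets (space M) (term_events C)" using u(2) by (rule compl_sets)
    show "space M - ev u \<in> events" "pcompl U u \<in> pcarrier U" using u(1) by auto
    show "AE x in M. x \<in> ev (pcompl U u) \<longleftrightarrow> x \<in> space M - ev u"
      using ev_compl[OF u(1)] AE_space by eventually_elim auto
  qed
  have inter: "pinter U u v \<in> ?T" if "u \<in> ?T" "v \<in> ?T" for u v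
    by (rule AE_I[of "ev u \<inter> ev v"]) (use that ev_inter[of u v] in auto)
  have union: "punion U u v \<in> ?T" if "u \<in> ?T" "v \<in> ?T" for u v
    by (rule AE_I[of "ev u \<union> ev v"]) (use that ev_union[of u v] in auto)
  have join: "s \<in> ?T" if X: "X \<subseteq> ?T" "countable X" "is_join U X s" for X s
  proof -
    have XU: "X \<subseteq> pcarrier U" using X by auto
    have "(\<Union>u\<in>X. ev u) \<in> sigma_sets (space M) (term_events C)" "(\<Union>u\<in>X. ev u) \<in> events"
      using X XU by (auto intro!: countable_UN' sets.countable_UN')
    moreover have "s \<in> pcarrier U" using X(3) by (simp add: is_join_def)
    ultimately show ?thesis
      using is_join_ev[OF XU X(2,3)] by (rule AE_I)
  qed
  show "sigma_subalgebra U ?T"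
    unfolding sigma_subalgebra_def
  proof (intro conjI ballI allI impI)
    show "?T \<subseteq> pcarrier U" by auto
    show "s \<in> ?T" if "X \<subseteq> ?T \<and> countable X \<and> is_join U X s" for X s
      using that by (elim conjE) (rule join)
  qed (fact zero one | (rule compl inter union; assumption))+
qed

lemma gen_carrier: "C \<subseteq> pcarrier U \<Longrightarrow> gen U C \<subseteq> pcarrier U"
  using gen_sigma_term_events by blast

abbreviation cond_sigma :: "'a set \<Rightarrow> 'x measure" where
  "cond_sigma C \<equiv> corr_sigma M h (gen U C)"

lemma
  assumes C: "C \<subseteq> pcarrier U"
  shows space_cond_sigma: "space (cond_sigma C) = space M"
    and sets_cond_sigma: "sets (cond_sigma C) = sigma_sets (space M) (\<Union>(h ` gen U C))"
    and subalgebra_cond_sigma: "subalgebra M (cond_sigma C)"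
proof -
  have sub: "\<Union>(h ` gen U C) \<subseteq> events"
    using gen_carrier[OF C] by (auto simp: h_members)
  then have "\<Union>(h ` gen U C) \<subseteq> Pow (space M)" using sets.sets_into_space by blast
  then show "space (cond_sigma C) = space M"
    "sets (cond_sigma C) = sigma_sets (space M) (\<Union>(h ` gen U C))"
    by (simp_all add: corr_sigma_def)
  then show "subalgebra M (cond_sigma C)"
    using sets.sigma_sets_subset[OF sub] by (auto simp: subalgebra_def)
qed

lemma ev_cond_sigma:
  assumes C: "C \<subseteq> pcarrier U" and c: "c \<in> C"
  shows "ev c \<in> sets (cond_sigma C)"
proof -
  have "c \<in> gen U C" using c hull_subset unfolding gen_def by fast
  moreover have "ev c \<in> h c" using c C by (auto simp: h_members)
  ultimately show ?thesis unfolding sets_cond_sigma[OF C] by blast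
qed

text \<open>This inclusion makes the intersection-stable family \<open>term_events C\<close>
  available for an induction over the conditioning sigma-algebra.\<close>

lemma sets_cond_sigma_subset:
  assumes C: "C \<subseteq> pcarrier U"
  shows "sets (cond_sigma C) \<subseteq> sigma_sets (space M) (term_events C)"
  unfolding sets_cond_sigma[OF C]
proof (rule sigma_sets_mono, safe)
  fix u A assume u: "u \<in> gen U C" and A: "A \<in> h u"
  have u': "u \<in> pcarrier U" "ev u \<in> sigma_sets (space M) (term_events C)"
    using gen_sigma_term_events[OF C] u by auto
  then have A': "A \<in> events" "AE x in M. x \<in> ev u \<longleftrightarrow> x \<in> A"
    using A by (simp_all add: h_members)
  have "AE x in M. x \<in> A \<longleftrightarrow> x \<in> ev u"
    using A'(2) by eventually_elim simp
  with u'(2) ev_events[OF u'(1)] A'(1) show "A \<in> sigma_sets (space M) (term_events C)"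
    by (rule sigma_term_events_AE)
qed

text \<open>A pi-lambda argument: agreement on the intersection-stable family
  \<open>term_events C\<close> passes to complements and countable disjoint unions.\<close>

lemma prob_Int_cond_sigma:
  assumes C: "C \<subseteq> pcarrier U" and X: "X \<in> events" and Y: "Y \<in> events"
    and eq: "\<And>t. t \<in> closed_terms C \<Longrightarrow> prob (X \<inter> cev t) = prob (Y \<inter> cev t)"
    and D: "D \<in> sets (cond_sigma C)"
  shows "prob (X \<inter> D) = prob (Y \<inter> D)"
proof -
  have te: "term_events C \<subseteq> Pow (space M)" "term_events C \<subseteq> events"
    by (auto simp: term_events_def dest: sets.sets_into_space)
  have ev: "A \<in> events" if "A \<in> sigma_sets (space M) (term_events C)" for A
    using that sets.sigma_sets_subset[OF te(2)] by auto
  have basic': "prob (X \<inter> A) = prob (Y \<inter> A)" if A: "A \<in> term_events C" for A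
  proof -
    obtain t where t: "A \<in> events" "t \<in> closed_terms C" "AE x in M. x \<in> A \<longleftrightarrow> x \<in> cev t"
      using A by (auto simp: term_events_def)
    have "prob (Z \<inter> A) = prob (Z \<inter> cev t)" if "Z \<in> events" for Z
      using that t cev_events[OF C t(2)] by (intro finite_measure_eq_AE) auto
    then show ?thesis using eq[OF t(2)] X Y by simp
  qed
  \<comment> \<open>The whole space is named by \<open>TOne\<close>, so the total measures agree;
    the complement case relies on this.\<close>
  have "AE x in M. x \<in> space M \<longleftrightarrow> x \<in> cev TOne"
    using ev_one AE_space unfolding cev_def tval.simps by eventually_elim auto
  then have "space M \<in> term_events C"
    using closed_terms_intros(3) by (auto simp: term_events_def)
  then have "prob (X \<inter> space M) = prob (Y \<inter> space M)" by (rule basic')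
  then have XY: "prob X = prob Y"
    using X Y by simp
  have "D \<in> sigma_sets (space M) (term_events C)"
    using D sets_cond_sigma_subset[OF C] by auto
  from Int_stable_term_events[OF C] te(1) this show ?thesis
  proof (induction rule: sigma_sets_induct_disjoint)
    case (basic A)
    then show ?case by (rule basic')
  next
    case empty
    then show ?case by simp
  next
    case (compl A)
    have "Z \<inter> (space M - A) = Z - (Z \<inter> A)" if "Z \<in> events" for Z
      using sets.sets_into_space[OF that] by auto
    then show ?case
      using ev[OF compl.hyps] compl.IH X Y XY by (simp add: finite_measure_Diff)
  next
    case (union A)
    have sums: "(\<lambda>i. prob (Z \<inter> A i)) sums prob (Z \<inter> (\<Union>i. A i))" if "Z \<in> events" for Z
    proof -
      have "(\<lambda>i. prob (Z \<inter> A i)) sums prob (\<Union>i. Z \<inter> A i)"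
        using union.hyps ev that
        by (intro finite_measure_UNION) (auto simp: disjoint_family_on_def)
      then show ?thesis by simp
    qed
    show ?case
      using sums[OF X] sums[OF Y] union.IH by (simp add: sums_unique2)
  qed
qed

section \<open>Integrals of conditional probabilities and their L1 distance\<close>

abbreviation cond_dist :: "'a set \<Rightarrow> 'a \<Rightarrow> 'a \<Rightarrow> real" where
  "cond_dist C u v \<equiv> L1_norm M (\<lambda>x. cprob M h (gen U C) u x - cprob M h (gen U C) v x)"

context
  fixes C :: "'a set"
  assumes C: "C \<subseteq> pcarrier U"
begin

lemma cprob_props:
  assumes u: "u \<in> pcarrier U"
  shows "cprob M h (gen U C) u \<in> borel_measurable (cond_sigma C)"
    and "integrable M (cprob M h (gen U C) u)"
    and "D \<in> sets (cond_sigma C) \<Longrightarrow> (LINT x:D|M. cprob M h (gen U C) u x) = prob (ev u \<inter> D)"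
proof -
  interpret F: finite_measure_subalgebra M "cond_sigma C"
    using subalgebra_cond_sigma[OF C] by unfold_locales
  have eq: "cprob M h (gen U C) u = real_cond_exp M (cond_sigma C) (indicator (ev u))"
    by (simp add: cprob_def ev_def fun_eq_iff)
  have int: "integrable M (indicator (ev u) :: 'x \<Rightarrow> real)"
    using u by (simp add: integrable_indicator_iff emeasure_eq_measure)
  show "cprob M h (gen U C) u \<in> borel_measurable (cond_sigma C)"
    unfolding eq by simp
  show "integrable M (cprob M h (gen U C) u)"
    unfolding eq by (rule F.real_cond_exp_int(1)[OF int])
  assume D: "D \<in> sets (cond_sigma C)"
  then have "D \<in> events" using subalgebra_cond_sigma[OF C] by (auto simp: subalgebra_def)
  have "(LINT x:D|M. cprob M h (gen U C) u x) = (LINT x:D|M. indicator (ev u) x)"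
    unfolding eq using F.real_cond_exp_intA[OF int D] by simp
  also have "\<dots> = (LINT x|M. indicator (ev u \<inter> D) x)"
    unfolding set_lebesgue_integral_def
    by (intro Bochner_Integration.integral_cong) (auto simp: indicator_def)
  also have "\<dots> = prob (ev u \<inter> D)"
    using sets.sets_into_space[OF \<open>D \<in> events\<close>] by (simp add: Int_absorb2 le_infI2)
  finally show "(LINT x:D|M. cprob M h (gen U C) u x) = prob (ev u \<inter> D)" .
qed

lemma cprob_diff_set_integral:
  assumes u: "u \<in> pcarrier U" and v: "v \<in> pcarrier U" and D: "D \<in> sets (cond_sigma C)"
  shows "set_integrable M D (\<lambda>x. cprob M h (gen U C) u x - cprob M h (gen U C) v x)"
    and "(LINT x:D|M. cprob M h (gen U C) u x - cprob M h (gen U C) v x) =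
      prob (ev u \<inter> D) - prob (ev v \<inter> D)"
proof -
  have De: "D \<in> events" using D subalgebra_cond_sigma[OF C] by (auto simp: subalgebra_def)
  have int: "set_integrable M D (cprob M h (gen U C) w)" if "w \<in> pcarrier U" for w
    unfolding set_integrable_def using De cprob_props(2)[OF that]
    by (rule integrable_mult_indicator)
  show "set_integrable M D (\<lambda>x. cprob M h (gen U C) u x - cprob M h (gen U C) v x)"
    using int[OF u] int[OF v] by (rule set_integral_diff)
  show "(LINT x:D|M. cprob M h (gen U C) u x - cprob M h (gen U C) v x) =
      prob (ev u \<inter> D) - prob (ev v \<inter> D)"
    using int[OF u] int[OF v] cprob_props(3)[OF u D] cprob_props(3)[OF v D]
    by (simp add: set_integral_diff)
qed

text \<open>On a cell of the conditioning sigma-algebra, the integral of the difference is a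
  difference of measures. Moving the absolute value inside the integrals and summing over the cells
  gives the L1 norm.\<close>

lemma cells_le_cond_dist:
  assumes u: "u \<in> pcarrier U" and v: "v \<in> pcarrier U" and J: "finite J"
    and Q: "\<And>j. j \<in> J \<Longrightarrow> Q j \<in> sets (cond_sigma C)" "disjoint_family_on Q J" "(\<Union>j\<in>J. Q j) = space M"
  shows "(\<Sum>j\<in>J. \<bar>prob (ev u \<inter> Q j) - prob (ev v \<inter> Q j)\<bar>) \<le> cond_dist C u v"
proof -
  define f where "f x = cprob M h (gen U C) u x - cprob M h (gen U C) v x" for x
  have abs: "\<bar>LINT x:Q j|M. f x\<bar> \<le> (LINT x:Q j|M. \<bar>f x\<bar>)" if "j \<in> J" for j
  proof -
    have "\<bar>LINT x:Q j|M. f x\<bar> \<le> (LINT x|M. \<bar>indicator (Q j) x *\<^sub>R f x\<bar>)"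
      unfolding set_lebesgue_integral_def by (rule integral_abs_bound)
    then show ?thesis by (simp add: set_lebesgue_integral_def abs_mult)
  qed
  have "(\<Sum>j\<in>J. \<bar>prob (ev u \<inter> Q j) - prob (ev v \<inter> Q j)\<bar>) = (\<Sum>j\<in>J. \<bar>LINT x:Q j|M. f x\<bar>)"
    using cprob_diff_set_integral(2)[OF u v Q(1)] by (simp add: f_def)
  also have "\<dots> \<le> (\<Sum>j\<in>J. LINT x:Q j|M. \<bar>f x\<bar>)"
    by (intro sum_mono abs)
  also have "\<dots> = (LINT x:(\<Union>j\<in>J. Q j)|M. \<bar>f x\<bar>)"
  proof (rule set_integral_finite_Union[symmetric, OF J Q(2)])
    fix j assume j: "j \<in> J"
    show "set_integrable M (Q j) (\<lambda>x. \<bar>f x\<bar>)"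
      using cprob_diff_set_integral(1)[OF u v Q(1)[OF j]] unfolding f_def
      by (rule set_integrable_abs)
    show "Q j \<in> events" using Q(1)[OF j] subalgebra_cond_sigma[OF C] by (auto simp: subalgebra_def)
  qed
  also have "\<dots> = (LINT x|M. \<bar>f x\<bar>)"
    unfolding Q(3) set_lebesgue_integral_def
    by (intro Bochner_Integration.integral_cong) auto
  also have "\<dots> = cond_dist C u v" by (simp add: L1_norm_def f_def)
  finally show ?thesis .
qed

text \<open>\<open>X\<close> and \<open>Y\<close> stand for the events of arbitrary realizations:
  they have the same measures as \<open>ev u\<close> and \<open>ev v\<close> on the conditioning
  sigma-algebra, so the integrals can be computed with them.\<close>

lemma cond_dist_le:
  assumes u: "u \<in> pcarrier U" and v: "v \<in> pcarrier U" and X: "X \<in> events" and Y: "Y \<in> events"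
    and eqX: "\<And>t. t \<in> closed_terms C \<Longrightarrow> prob (X \<inter> cev t) = prob (ev u \<inter> cev t)"
    and eqY: "\<And>t. t \<in> closed_terms C \<Longrightarrow> prob (Y \<inter> cev t) = prob (ev v \<inter> cev t)"
  shows "cond_dist C u v \<le> prob (sym_diff X Y)"
proof -
  define f where "f x = cprob M h (gen U C) u x - cprob M h (gen U C) v x" for x
  \<comment> \<open>The set where the integrand is nonnegative. It lies in the conditioning
    sigma-algebra, so the integrals over it and its complement are differences of measures.\<close>
  define D where "D = {x \<in> space M. f x \<ge> 0}"
  have "f \<in> borel_measurable (cond_sigma C)"
    unfolding f_def using cprob_props(1)[OF u] cprob_props(1)[OF v] by (rule borel_measurable_diff)
  then have "{x \<in> space (cond_sigma C). f x \<ge> 0} \<in> sets (cond_sigma C)" by measurable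
  then have D: "D \<in> sets (cond_sigma C)" by (simp add: D_def space_cond_sigma[OF C])
  then have D': "space M - D \<in> sets (cond_sigma C)"
    using sets.compl_sets[of D "cond_sigma C"] by (simp add: space_cond_sigma[OF C])
  have ev: "D \<in> events" "space M - D \<in> events"
    using D D' subalgebra_cond_sigma[OF C] by (auto simp: subalgebra_def)
  have int: "set_integrable M D f" "set_integrable M (space M - D) f"
    unfolding f_def by (intro cprob_diff_set_integral u v D D')+
  have val: "(LINT x:E|M. f x) = prob (X \<inter> E) - prob (Y \<inter> E)" if E: "E \<in> sets (cond_sigma C)" for E
    unfolding f_def cprob_diff_set_integral(2)[OF u v E]
    using prob_Int_cond_sigma[OF C X ev_events[OF u] eqX E] prob_Int_cond_sigma[OF C Y ev_events[OF v] eqY E]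
    by simp
  have "cond_dist C u v = (LINT x|M. \<bar>f x\<bar>)" by (simp add: L1_norm_def f_def)
  also have "\<dots> = (LINT x|M. indicator D x *\<^sub>R f x - indicator (space M - D) x *\<^sub>R f x)"
    by (intro Bochner_Integration.integral_cong) (auto simp: D_def indicator_def)
  also have "\<dots> = (LINT x:D|M. f x) - (LINT x:space M - D|M. f x)"
    using int unfolding set_integrable_def set_lebesgue_integral_def
    by (rule Bochner_Integration.integral_diff)
  also have "\<dots> = (prob (X \<inter> D) - prob (Y \<inter> D)) + (prob (Y \<inter> (space M - D)) - prob (X \<inter> (space M - D)))"
    using val[OF D] val[OF D'] by simp
  also have "\<dots> \<le> prob (sym_diff X Y \<inter> D) + prob (sym_diff X Y \<inter> (space M - D))"
  proof (rule add_mono)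
    have "prob (A \<inter> E) \<le> prob (B \<inter> E) + prob (sym_diff A B \<inter> E)"
      if "A \<in> events" "B \<in> events" "E \<in> events" for A B E
    proof -
      have "prob (A \<inter> E) \<le> prob ((B \<inter> E) \<union> (sym_diff A B \<inter> E))"
        using that by (intro finite_measure_mono) auto
      also have "\<dots> \<le> prob (B \<inter> E) + prob (sym_diff A B \<inter> E)"
        using that by (intro measure_Un_le) auto
      finally show ?thesis .
    qed
    note this[OF X Y ev(1)] this[OF Y X ev(2)]
    then show "prob (X \<inter> D) - prob (Y \<inter> D) \<le> prob (sym_diff X Y \<inter> D)"
      "prob (Y \<inter> (space M - D)) - prob (X \<inter> (space M - D)) \<le> prob (sym_diff X Y \<inter> (space M - D))"
      by (simp_all add: Un_commute)
  qed
  also have "\<dots> = prob ((sym_diff X Y \<inter> D) \<union> (sym_diff X Y \<inter> (space M - D)))"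
    using X Y ev by (intro finite_measure_Union[symmetric]) auto
  also have "(sym_diff X Y \<inter> D) \<union> (sym_diff X Y \<inter> (space M - D)) = sym_diff X Y"
    using sets.sets_into_space[OF X] sets.sets_into_space[OF Y] by auto
  finally show ?thesis .
qed

end

section \<open>Partitions and their types\<close>

text \<open>Elements with meet zero have representatives overlapping in null sets. Subtracting the
  earlier events gives disjoint sets, as finite additivity requires.\<close>

lemma disjoint_representatives:
  fixes n :: nat
  assumes v: "v \<in> {..<n} \<rightarrow> pcarrier U"
    and disj: "\<And>i j. i < n \<Longrightarrow> j < n \<Longrightarrow> i \<noteq> j \<Longrightarrow> prob (ev (v i) \<inter> ev (v j)) = 0"
  obtains A where "\<And>i. i < n \<Longrightarrow> A i \<in> events"
    "\<And>i. i < n \<Longrightarrow> AE x in M. x \<in> A i \<longleftrightarrow> x \<in> ev (v i)" "disjoint_family_on A {..<n}"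
proof
  define A where "A i = ev (v i) - (\<Union>j<i. ev (v j))" for i
  have inU: "v i \<in> pcarrier U" if "i < n" for i using v that by auto
  show "A i \<in> events" if "i < n" for i
  proof -
    have "(\<Union>j<i. ev (v j)) \<in> events"
      using inU \<open>i < n\<close> by (intro sets.finite_UN) auto
    then show ?thesis using inU[OF that] by (simp add: A_def sets.Diff)
  qed
  show "AE x in M. x \<in> A i \<longleftrightarrow> x \<in> ev (v i)" if "i < n" for i
  proof -
    have "AE x in M. x \<notin> ev (v i) \<inter> ev (v j)" if "j < i" for j
      using disj[of i j] inU \<open>i < n\<close> that prob_eq_0[of "ev (v i) \<inter> ev (v j)"] by auto
    then have "AE x in M. \<forall>j\<in>{..<i}. x \<notin> ev (v i) \<inter> ev (v j)"
      by (subst AE_ball_countable) auto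
    then show ?thesis by eventually_elim (auto simp: A_def)
  qed
  show "disjoint_family_on A {..<n}"
    unfolding disjoint_family_on_def
  proof (intro ballI impI)
    fix i j :: nat assume "i \<noteq> j"
    then have "i < j \<or> j < i" by auto
    then show "A i \<inter> A j = {}" by (auto simp: A_def)
  qed
qed

lemma AE_partition:
  assumes v: "partition_of_one U n v"
  shows "AE x in M. \<exists>!i. i < n \<and> x \<in> ev (v i)"
proof -
  have vU: "v \<in> {..<n} \<rightarrow> pcarrier U" using v by (simp add: partition_of_one_def)
  note p = v[unfolded partition_of_one_ev[OF vU]]
  obtain A where A: "\<And>i. i < n \<Longrightarrow> A i \<in> events"
    "\<And>i. i < n \<Longrightarrow> AE x in M. x \<in> A i \<longleftrightarrow> x \<in> ev (v i)" "disjoint_family_on A {..<n}"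
    using disjoint_representatives[OF vU] p by blast
  have "AE x in M. \<forall>i\<in>{..<n}. x \<in> A i \<longleftrightarrow> x \<in> ev (v i)"
    using A(2) by (subst AE_ball_countable) auto
  then show ?thesis
    using conjunct2[OF p]
  proof eventually_elim
    case (elim x)
    then obtain i where i: "i < n" "x \<in> ev (v i)" by auto
    have uniq: "j = i" if j: "j < n" "x \<in> ev (v j)" for j
    proof (rule ccontr)
      assume "j \<noteq> i"
      then have "A j \<inter> A i = {}" using A(3) i(1) j(1) by (auto simp: disjoint_family_on_def)
      moreover have "x \<in> A j" "x \<in> A i" using elim(1) i j by auto
      ultimately show False by auto
    qed
    show ?case by (rule ex1I[of _ i]) (use i uniq in blast)+
  qed
qed

lemma sum_prob_partition:
  assumes v: "partition_of_one U n v" and Q: "Q \<in> events"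
  shows "(\<Sum>i<n. prob (ev (v i) \<inter> Q)) = prob Q"
proof -
  have vU: "v \<in> {..<n} \<rightarrow> pcarrier U" using v by (simp add: partition_of_one_def)
  note p = v[unfolded partition_of_one_ev[OF vU]]
  have evv: "ev (v i) \<in> events" if "i < n" for i using vU that by auto
  obtain A where A: "\<And>i. i < n \<Longrightarrow> A i \<in> events"
    "\<And>i. i < n \<Longrightarrow> AE x in M. x \<in> A i \<longleftrightarrow> x \<in> ev (v i)" "disjoint_family_on A {..<n}"
    using disjoint_representatives[OF vU] p by blast
  have "(\<Sum>i<n. prob (ev (v i) \<inter> Q)) = (\<Sum>i<n. prob (A i \<inter> Q))"
  proof (rule sum.cong[OF refl])
    fix i assume "i \<in> {..<n}"
    then have i: "i < n" by simp
    then show "prob (ev (v i) \<inter> Q) = prob (A i \<inter> Q)"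
      using A(1,2)[OF i] evv[OF i] Q by (intro finite_measure_eq_AE) auto
  qed
  also have "\<dots> = prob (\<Union>i<n. A i \<inter> Q)"
    using A(1,3) Q by (intro finite_measure_finite_Union[symmetric]) (auto simp: disjoint_family_on_def)
  also have "\<dots> = prob Q"
  proof (rule finite_measure_eq_AE)
    have "AE x in M. \<forall>i\<in>{..<n}. x \<in> A i \<longleftrightarrow> x \<in> ev (v i)"
      using A(2) by (subst AE_ball_countable) auto
    then show "AE x in M. x \<in> (\<Union>i<n. A i \<inter> Q) \<longleftrightarrow> x \<in> Q"
      using conjunct2[OF p] by eventually_elim auto
    show "(\<Union>i<n. A i \<inter> Q) \<in> events" using A(1) Q by (intro sets.finite_UN) auto
  qed (rule Q)
  finally show ?thesis .
qed

text \<open>Almost disjoint events of total measure 1 cover almost everything. The join condition is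
  thus replaced by a statement about measures, which a type can express.\<close>

lemma partition_of_oneI:
  assumes v: "v \<in> {..<n} \<rightarrow> pcarrier U"
    and disj: "\<And>i j. i < n \<Longrightarrow> j < n \<Longrightarrow> i \<noteq> j \<Longrightarrow> prob (ev (v i) \<inter> ev (v j)) = 0"
    and sum: "(\<Sum>i<n. prob (ev (v i))) = 1"
  shows "partition_of_one U n v"
proof -
  have evv: "ev (v i) \<in> events" if "i < n" for i using v that by auto
  obtain A where A: "\<And>i. i < n \<Longrightarrow> A i \<in> events"
    "\<And>i. i < n \<Longrightarrow> AE x in M. x \<in> A i \<longleftrightarrow> x \<in> ev (v i)" "disjoint_family_on A {..<n}"
    using disjoint_representatives[OF v disj] by blast
  have "prob (\<Union>i<n. A i) = (\<Sum>i<n. prob (A i))"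
    using A by (intro finite_measure_finite_Union) auto
  also have "\<dots> = (\<Sum>i<n. prob (ev (v i)))"
    using A(1,2) evv by (intro sum.cong finite_measure_eq_AE) auto
  finally have "prob (\<Union>i<n. A i) = 1" using sum by simp
  moreover have "(\<Union>i<n. A i) \<in> events" using A(1) by (intro sets.finite_UN) auto
  ultimately have "AE x in M. x \<in> (\<Union>i<n. A i)"
    using prob_eq_1 by blast
  moreover have "AE x in M. \<forall>i\<in>{..<n}. x \<in> A i \<longleftrightarrow> x \<in> ev (v i)"
    using A(2) by (subst AE_ball_countable) auto
  ultimately have "AE x in M. \<exists>i<n. x \<in> ev (v i)"
    by eventually_elim auto
  then show ?thesis
    using disj by (simp add: partition_of_one_ev[OF v])
qed

text \<open>Almost every point lies in exactly one member of the partition, so its pattern consists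
  of one variable and a set of constants. All other cells are null, and the joint distribution
  reduces to the measures of \<open>v i\<close> in the cells of \<open>K\<close>.\<close>

lemma prob_partition_cell:
  assumes v: "partition_of_one U n v"
    and K: "K \<subseteq> range Const" "finite K" "\<And>t. t \<in> K \<Longrightarrow> tval U t v \<in> pcarrier U"
  shows "i < n \<Longrightarrow> J = insert (Var i) (J \<inter> K) \<Longrightarrow>
      prob (cell (Var ` {..<n} \<union> K) v J) = prob (ev (v i) \<inter> cell K v (J \<inter> K))"
    and "\<not> (\<exists>i<n. J = insert (Var i) (J \<inter> K)) \<Longrightarrow> prob (cell (Var ` {..<n} \<union> K) v J) = 0"
proof -
  have vU: "v \<in> {..<n} \<rightarrow> pcarrier U" using v by (simp add: partition_of_one_def)
  have admK: "admissible K v" and adm: "admissible (Var ` {..<n} \<union> K) v"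
    using K vU by (auto simp: admissible_def)
  have VK: "Var i \<notin> K" for i using K by auto
  have pat: "AE x in M. \<exists>i<n. x \<in> ev (v i) \<and>
      pattern (Var ` {..<n} \<union> K) v x = insert (Var i) (pattern K v x) \<and>
      (\<forall>j<n. x \<in> ev (v j) \<longrightarrow> j = i)"
    using AE_partition[OF v]
  proof eventually_elim
    case (elim x)
    then obtain i where i: "i < n" "x \<in> ev (v i)" "\<forall>j<n. x \<in> ev (v j) \<longrightarrow> j = i" by auto
    have "{t \<in> Var ` {..<n}. x \<in> ev (tval U t v)} \<subseteq> {Var i}"
    proof
      fix t assume "t \<in> {t \<in> Var ` {..<n}. x \<in> ev (tval U t v)}"
      then obtain j where "t = Var j" "j < n" "x \<in> ev (v j)" by auto
      then show "t \<in> {Var i}" using i(3) by blast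
    qed
    moreover have "Var i \<in> {t \<in> Var ` {..<n}. x \<in> ev (tval U t v)}"
      using i(1,2) by auto
    ultimately have "pattern (Var ` {..<n} \<union> K) v x = insert (Var i) (pattern K v x)"
      unfolding pattern_def by blast
    with i show ?case by blast
  qed
  \<comment> \<open>\<open>K\<close> contains only constants, so intersecting with it removes the
    variable.\<close>
  have pK: "insert (Var j) (pattern K v x) \<inter> K = pattern K v x" for j x
    using VK by (auto simp: pattern_def)
  show "prob (cell (Var ` {..<n} \<union> K) v J) = prob (ev (v i) \<inter> cell K v (J \<inter> K))"
    if i: "i < n" "J = insert (Var i) (J \<inter> K)"
  proof (rule finite_measure_eq_AE)
    show "AE x in M. x \<in> cell (Var ` {..<n} \<union> K) v J \<longleftrightarrow> x \<in> ev (v i) \<inter> cell K v (J \<inter> K)"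
      using pat AE_space
    proof eventually_elim
      case (elim x)
      then obtain j where j: "j < n" "x \<in> ev (v j)"
        "pattern (Var ` {..<n} \<union> K) v x = insert (Var j) (pattern K v x)"
        "\<forall>k<n. x \<in> ev (v k) \<longrightarrow> k = j" by blast
      have "insert (Var j) (pattern K v x) = J \<longleftrightarrow> j = i \<and> pattern K v x = J \<inter> K"
      proof
        assume eq: "insert (Var j) (pattern K v x) = J"
        then have "pattern K v x = J \<inter> K" using pK[of j x] by simp
        moreover have "Var i \<in> insert (Var j) (pattern K v x)" unfolding eq using i(2) by blast
        then have "j = i" using VK[of i] pattern_subset[of K v x] by auto
        ultimately show "j = i \<and> pattern K v x = J \<inter> K" by simp
      next
        assume "j = i \<and> pattern K v x = J \<inter> K"
        then show "insert (Var j) (pattern K v x) = J" using i(2) by simp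
      qed
      moreover have "x \<in> ev (v i) \<longleftrightarrow> j = i" using j(2,4) i(1) by blast
      ultimately show ?case using elim(2) j(3) by (simp add: cell_def)
    qed
    show "cell (Var ` {..<n} \<union> K) v J \<in> events" by (rule cell_events[OF adm])
    show "ev (v i) \<inter> cell K v (J \<inter> K) \<in> events" using cell_events[OF admK] vU i(1) by auto
  qed
  show "prob (cell (Var ` {..<n} \<union> K) v J) = 0" if J: "\<not> (\<exists>i<n. J = insert (Var i) (J \<inter> K))"
  proof -
    have "AE x in M. x \<notin> cell (Var ` {..<n} \<union> K) v J"
      using pat
    proof eventually_elim
      case (elim x)
      then obtain j where j: "j < n"
        "pattern (Var ` {..<n} \<union> K) v x = insert (Var j) (pattern K v x)" by blast
      have "pattern (Var ` {..<n} \<union> K) v x \<noteq> J"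
      proof
        assume "pattern (Var ` {..<n} \<union> K) v x = J"
        then have "J = insert (Var j) (pattern K v x)" "J \<inter> K = pattern K v x"
          using j(2) pK[of j x] by simp_all
        then show False using J j(1) by auto
      qed
      then show ?case by (simp add: cell_def)
    qed
    then show ?thesis using cell_events[OF adm] by (simp add: prob_eq_0)
  qed
qed

section \<open>What a type over \<open>C\<close> says about measures\<close>

lemma cell_Const:
  assumes "K \<subseteq> range Const"
  shows "cell K v J = cell K w J"
proof -
  have "tval U t v = tval U t w" if "t \<in> K" for t using that assms by auto
  then show ?thesis by (auto simp: cell_def pattern_def)
qed

lemma cell_cond_sigma:
  assumes C: "C \<subseteq> pcarrier U" and K: "K \<subseteq> Const ` C" "finite K"
  shows "cell K v J \<in> sets (cond_sigma C)"
proof (rule cell_in_sigma_algebra)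
  show "sigma_algebra (space M) (sets (cond_sigma C))"
    using sets.sigma_algebra_axioms[of "cond_sigma C"] by (simp add: space_cond_sigma[OF C])
qed (use K ev_cond_sigma[OF C] in auto)

lemma fval_Mu_Meet:
  assumes C: "C \<subseteq> pcarrier U" and "v i \<in> pcarrier U" "t \<in> closed_terms C"
  shows "fval U (Mu (Meet (Var i) t)) v = prob (ev (v i) \<inter> cev t)"
  using assms closed_term_carrier[OF C assms(3)] ev_closed_term[OF assms(3)]
  by (simp add: prob_pinter)

lemma Mu_Meet_formulas:
  "i < n \<Longrightarrow> t \<in> closed_terms C \<Longrightarrow> Mu (Meet (Var i) t) \<in> formulas C n"
  by (auto simp: formulas_def closed_terms_def)

lemma realizes_tp_prob:
  assumes C: "C \<subseteq> pcarrier U" and v: "v \<in> {..<n} \<rightarrow> pcarrier U"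
    and w: "realizes U n w (tp U n C v)" and i: "i < n" and t: "t \<in> closed_terms C"
  shows "prob (ev (w i) \<inter> cev t) = prob (ev (v i) \<inter> cev t)"
proof -
  have vi: "v i \<in> pcarrier U" and wi: "w i \<in> pcarrier U"
    using v w i by (auto simp: realizes_def)
  \<comment> \<open>A type records only formulas of value 0; \<open>near\<close> with the actual
    measure as target and tolerance 0 encodes that measure in such a formula.\<close>
  define \<phi> where "\<phi> = near (prob (ev (v i) \<inter> cev t)) 0 (Mu (Meet (Var i) t))"
  have "\<phi> \<in> formulas C n"
    unfolding \<phi>_def by (intro near_formulas Mu_Meet_formulas i t) auto
  moreover have "fval U \<phi> v = 0"
    using fval_Mu_Meet[OF C _ t, of v i] vi by (simp add: \<phi>_def fval_near del: fval.simps)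
  ultimately have "fval U \<phi> w = 0"
    using w by (auto simp: realizes_def tp_def)
  then show ?thesis
    using fval_Mu_Meet[OF C _ t, of w i] wi by (simp add: \<phi>_def fval_near del: fval.simps)
qed

lemma cond_dist_le_pdist:
  assumes C: "C \<subseteq> pcarrier U" and u: "u \<in> pcarrier U" "u' \<in> pcarrier U"
    and v: "v \<in> pcarrier U" "v' \<in> pcarrier U"
    and "\<And>t. t \<in> closed_terms C \<Longrightarrow> prob (ev u' \<inter> cev t) = prob (ev u \<inter> cev t)"
    and "\<And>t. t \<in> closed_terms C \<Longrightarrow> prob (ev v' \<inter> cev t) = prob (ev v \<inter> cev t)"
  shows "cond_dist C u v \<le> pdist U u' v'"
  unfolding pdist_ev[OF u(2) v(2)]
  by (rule cond_dist_le[OF C u(1) v(1)]) (use assms in auto)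

end

section \<open>Types of partitions and the partition at minimal distance\<close>

context apa_domain
begin

text \<open>The equalities for closed terms extend to the conditioning sigma-algebra, hence to all
  cells of the constants of a formula. The joint distributions then agree, and quantifier
  elimination applies.\<close>

lemma tp_eq_partition:
  assumes C: "C \<subseteq> pcarrier U" and v: "partition_of_one U n v" and w: "partition_of_one U n w"
    and eq: "\<And>i t. i < n \<Longrightarrow> t \<in> closed_terms C \<Longrightarrow> prob (ev (v i) \<inter> cev t) = prob (ev (w i) \<inter> cev t)"
  shows "tp U n C v = tp U n C w"
proof -
  have vU: "v \<in> {..<n} \<rightarrow> pcarrier U" "w \<in> {..<n} \<rightarrow> pcarrier U"
    using v w by (simp_all add: partition_of_one_def)
  have "fval U \<phi> v = fval U \<phi> w" if \<phi>: "\<phi> \<in> formulas C n" for \<phi>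
  proof -
    define K where "K = Const ` fconsts \<phi>"
    have K: "finite K" "K \<subseteq> Const ` C" "K \<subseteq> range Const"
      using \<phi> by (auto simp: K_def finite_fconsts formulas_def)
    have KU: "tval U t u \<in> pcarrier U" if tK: "t \<in> K" for t u
    proof -
      obtain c where "t = Const c" "c \<in> C" using tK K(2) by auto
      then show ?thesis using C by auto
    qed
    have "similar (Var ` {..<n} \<union> K) v w"
      unfolding similar_def
    proof
      fix J
      have eq_cell: "prob (ev (v i) \<inter> cell K v L) = prob (ev (w i) \<inter> cell K w L)" if i: "i < n" for i L
      proof -
        have "ev (v i) \<in> events" "ev (w i) \<in> events" using vU i by auto
        from prob_Int_cond_sigma[OF C this eq[OF i] cell_cond_sigma[OF C K(2,1)]]
        show ?thesis by (simp add: cell_Const[OF K(3), of w _ v])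
      qed
      show "prob (cell (Var ` {..<n} \<union> K) v J) = prob (cell (Var ` {..<n} \<union> K) w J)"
      proof (cases "\<exists>i<n. J = insert (Var i) (J \<inter> K)")
        case True
        then obtain i where i: "i < n" "J = insert (Var i) (J \<inter> K)" by blast
        show ?thesis
          using prob_partition_cell(1)[OF v K(3,1) KU i] prob_partition_cell(1)[OF w K(3,1) KU i]
            eq_cell[OF i(1)] by simp
      next
        case False
        show ?thesis
          using prob_partition_cell(2)[OF v K(3,1) KU False] prob_partition_cell(2)[OF w K(3,1) KU False]
          by simp
      qed
    qed
    moreover have "admissible (Var ` {..<n} \<union> K) u" if "u \<in> {..<n} \<rightarrow> pcarrier U" for u
      using that K KU by (auto simp: admissible_def)
    ultimately show ?thesis
      using vU \<phi> by (intro fval_similar) (auto simp: K_def formulas_def)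
  qed
  then show ?thesis by (auto simp: tp_def)
qed

text \<open>
  The distances are only bounded from above: the reverse inequality holds for every realization,
  and over a finite part of \<open>C\<close> the distance reached may be smaller than over \<open>C\<close>.
\<close>

definition transport_type :: "'a set \<Rightarrow> (nat \<Rightarrow> real) \<Rightarrow> nat \<Rightarrow> (nat \<Rightarrow> 'a) \<Rightarrow> (nat \<Rightarrow> 'a) \<Rightarrow> 'a fm set" where
  "transport_type C r n a b =
    {near (prob (ev (b i) \<inter> cev t)) 0 (Mu (Meet (Var i) t)) | i t. i < n \<and> t \<in> closed_terms C} \<union>
    {near 0 0 (Mu (Meet (Var i) (Var j))) | i j. i < n \<and> j < n \<and> i \<noteq> j} \<union>
    {near 0 (r i) (Dist (Const (a i)) (Var i)) | i. i < n}"

lemma realizes_transport_type: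
  assumes C: "C \<subseteq> pcarrier U" and a: "a \<in> {..<n} \<rightarrow> pcarrier U"
    and x: "x \<in> {..<n} \<rightarrow> pcarrier U"
  shows "realizes U n x (transport_type C r n a b) \<longleftrightarrow>
    (\<forall>i<n. \<forall>t\<in>closed_terms C. prob (ev (x i) \<inter> cev t) = prob (ev (b i) \<inter> cev t)) \<and>
    (\<forall>i<n. \<forall>j<n. i \<noteq> j \<longrightarrow> prob (ev (x i) \<inter> ev (x j)) = 0) \<and>
    (\<forall>i<n. pdist U (a i) (x i) \<le> r i)"
proof -
  have xU: "x i \<in> pcarrier U" if "i < n" for i using x that by auto
  have aU: "a i \<in> pcarrier U" if "i < n" for i using a that by auto
  have 1: "fval U (near (prob (ev (b i) \<inter> cev t)) 0 (Mu (Meet (Var i) t))) x = 0 \<longleftrightarrow>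
      prob (ev (x i) \<inter> cev t) = prob (ev (b i) \<inter> cev t)" if "i < n" "t \<in> closed_terms C" for i t
    using fval_Mu_Meet[OF C _ that(2), of x i] xU[OF that(1)] by (simp add: fval_near del: fval.simps)
  have 2: "fval U (near 0 0 (Mu (Meet (Var i) (Var j)))) x = 0 \<longleftrightarrow> prob (ev (x i) \<inter> ev (x j)) = 0"
    if "i < n" "j < n" for i j
    using xU that by (simp add: fval_near prob_pinter measure_le_0_iff)
  have 3: "fval U (near 0 (r i) (Dist (Const (a i)) (Var i))) x = 0 \<longleftrightarrow> pdist U (a i) (x i) \<le> r i"
    if "i < n" for i
    using xU[OF that] aU[OF that] by (simp add: fval_near pdist_ev)
  have "realizes U n x (transport_type C r n a b) \<longleftrightarrow>
    (\<forall>i<n. \<forall>t\<in>closed_terms C. fval U (near (prob (ev (b i) \<inter> cev t)) 0 (Mu (Meet (Var i) t))) x = 0) \<and>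
    (\<forall>i<n. \<forall>j<n. i \<noteq> j \<longrightarrow> fval U (near 0 0 (Mu (Meet (Var i) (Var j)))) x = 0) \<and>
    (\<forall>i<n. fval U (near 0 (r i) (Dist (Const (a i)) (Var i))) x = 0)"
    unfolding realizes_def transport_type_def using x by blast
  then show ?thesis using 1 2 3 by (simp cong: conj_cong)
qed

lemma transport_type_formulas:
  assumes "\<And>i. i < n \<Longrightarrow> 0 \<le> r i"
  shows "transport_type C r n a b \<subseteq> formulas (C \<union> a ` {..<n}) n"
proof -
  have "near (prob (ev (b i) \<inter> cev t)) 0 (Mu (Meet (Var i) t)) \<in> formulas (C \<union> a ` {..<n}) n"
    if "i < n" "t \<in> closed_terms C" for i t
    using that by (intro near_formulas Mu_Meet_formulas) (auto simp: closed_terms_def)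
  moreover have "near 0 0 (Mu (Meet (Var i) (Var j))) \<in> formulas (C \<union> a ` {..<n}) n"
    if "i < n" "j < n" for i j
    using that by (intro near_formulas) (auto simp: formulas_def)
  moreover have "near 0 (r i) (Dist (Const (a i)) (Var i)) \<in> formulas (C \<union> a ` {..<n}) n"
    if "i < n" for i
    using that assms by (intro near_formulas) (auto simp: formulas_def)
  ultimately show ?thesis unfolding transport_type_def by blast
qed

text \<open>Only the first family of conditions depends on \<open>C\<close>, and each formula
  contains finitely many constants.\<close>

lemma finite_subset_transport_type:
  assumes "\<Gamma> \<subseteq> transport_type C r n a b" "finite \<Gamma>"
  obtains K where "finite K" "K \<subseteq> C" "\<Gamma> \<subseteq> transport_type K r n a b"
proof
  \<comment> \<open>Intersecting with \<open>C\<close> discards constants \<open>a i\<close> lying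
    outside \<open>C\<close>, which come from the distance conditions.\<close>
  define K where "K = C \<inter> (\<Union>\<phi>\<in>\<Gamma>. fconsts \<phi>)"
  show "finite K" "K \<subseteq> C"
    using assms(2) by (auto simp: K_def finite_fconsts)
  show "\<Gamma> \<subseteq> transport_type K r n a b"
  proof
    fix \<phi> assume \<phi>: "\<phi> \<in> \<Gamma>"
    then have "\<phi> \<in> transport_type C r n a b" using assms(1) by auto
    then consider (mu) i t where "i < n" "t \<in> closed_terms C"
        "\<phi> = near (prob (ev (b i) \<inter> cev t)) 0 (Mu (Meet (Var i) t))"
      | (other) "\<phi> \<in> transport_type {} r n a b \<or> \<phi> \<in> transport_type K r n a b"
      unfolding transport_type_def by blast
    then show "\<phi> \<in> transport_type K r n a b"
    proof cases
      case mu
      then have "tconsts t \<subseteq> fconsts \<phi>" by (simp add: near_def)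
      then have "t \<in> closed_terms K"
        using mu(2) \<phi> by (auto simp: closed_terms_def K_def)
      with mu show ?thesis unfolding transport_type_def by blast
    next
      case other
      moreover have "closed_terms {} \<subseteq> closed_terms K" by (auto simp: closed_terms_def)
      ultimately show ?thesis unfolding transport_type_def by blast
    qed
  qed
qed

text \<open>Finite satisfiability. The constants in \<open>K\<close> cut the space into finitely
  many cells, in which the mass of \<open>a\<close> is redistributed according to
  \<open>b\<close>.\<close>

lemma transport_finite:
  assumes C: "C \<subseteq> pcarrier U" and K: "finite K" "K \<subseteq> C"
    and a: "partition_of_one U n a" and b: "partition_of_one U n b"
  obtains x where "realizes U n x (transport_type K (\<lambda>i. cond_dist C (a i) (b i)) n a b)"
proof -
  have aU: "a \<in> {..<n} \<rightarrow> pcarrier U" and bU: "b \<in> {..<n} \<rightarrow> pcarrier U"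
    using a b by (simp_all add: partition_of_one_def)
  then have aiU: "a i \<in> pcarrier U" and biU: "b i \<in> pcarrier U" if "i < n" for i
    using that by auto
  have KU: "K \<subseteq> pcarrier U" using K C by blast
  \<comment> \<open>The dummy assignment of \<open>cev\<close>, so that closed terms have the same
    events under both.\<close>
  define v where "v = (\<lambda>_::nat. pzero U)"
  define I where "I = Const ` K"
  have I: "finite I" "I \<subseteq> Const ` C" "admissible I v"
    using K KU by (auto simp: I_def admissible_def)
  obtain A where A: "\<And>i. i < n \<Longrightarrow> A i \<in> events"
    "\<And>i. i < n \<Longrightarrow> AE x in M. x \<in> A i \<longleftrightarrow> x \<in> ev (a i)" "disjoint_family_on A {..<n}"
    using disjoint_representatives[OF aU] a[unfolded partition_of_one_ev[OF aU]] by blast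
  have probA: "prob (A i \<inter> Q) = prob (ev (a i) \<inter> Q)" if "i < n" "Q \<in> events" for i Q
    using A(1,2)[OF that(1)] aiU[OF that(1)] that(2) by (intro finite_measure_eq_AE) auto
  obtain B where B: "\<And>i. i < n \<Longrightarrow> B i \<in> events" "disjoint_family_on B {..<n}"
    "\<And>i J. i < n \<Longrightarrow> J \<subseteq> I \<Longrightarrow> prob (B i \<inter> cell I v J) = prob (ev (b i) \<inter> cell I v J)"
    "\<And>i. i < n \<Longrightarrow> prob (sym_diff (A i) (B i)) \<le>
      (\<Sum>J\<in>Pow I. \<bar>prob (A i \<inter> cell I v J) - prob (ev (b i) \<inter> cell I v J)\<bar>)"
  proof (rule redistribution_cells[of "{..<n}" "Pow I" "cell I v" A "\<lambda>i. ev (b i)"])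
    show "(\<Sum>i<n. prob (ev (b i) \<inter> cell I v J)) = prob (cell I v J)" for J
      by (rule sum_prob_partition[OF b cell_events[OF I(3)]])
  qed (use A biU I cell_events disjoint_cells Un_cells in auto)
  have "\<forall>i. \<exists>u. i < n \<longrightarrow> u \<in> pcarrier U \<and> (AE x in M. x \<in> ev u \<longleftrightarrow> x \<in> B i)"
    using B(1) ev_surj by metis
  then obtain x where x: "\<And>i. i < n \<Longrightarrow> x i \<in> pcarrier U"
    "\<And>i. i < n \<Longrightarrow> AE z in M. z \<in> ev (x i) \<longleftrightarrow> z \<in> B i" by metis
  have "realizes U n x (transport_type K (\<lambda>i. cond_dist C (a i) (b i)) n a b)"
  proof (subst realizes_transport_type[OF KU aU], goal_cases)
    case 1
    then show ?case using x(1) by auto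
  next
    case 2
    show ?case
    proof (intro conjI allI impI ballI)
      fix i t assume i: "i < n" and t: "t \<in> closed_terms K"
      have tI: "Var ` tvars t \<union> Const ` tconsts t \<subseteq> I"
        using t by (auto simp: closed_terms_def I_def)
      have cev: "AE z in M. z \<in> cev t \<longleftrightarrow> tm_holds t (pattern I v z)"
        using ev_tval[OF I(3) tI] by (simp add: cev_def v_def)
      \<comment> \<open>A closed term over \<open>K\<close> is almost surely a union of cells, so
        equal measures in the cells give equal measures on the term.\<close>
      have sum: "prob (E \<inter> cev t) = (\<Sum>J | J \<subseteq> I \<and> tm_holds t J. prob (E \<inter> cell I v J))"
        if E: "E \<in> events" for E
      proof -
        have "prob (E \<inter> cev t) = prob {z \<in> E. tm_holds t (pattern I v z)}"
        proof (rule finite_measure_eq_AE)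
          show "AE z in M. z \<in> E \<inter> cev t \<longleftrightarrow> z \<in> {z \<in> E. tm_holds t (pattern I v z)}"
            using cev by eventually_elim auto
          show "E \<inter> cev t \<in> events" using E cev_events[OF KU t] by auto
        qed (rule prob_cells(1)[OF I(3) E])
        then show ?thesis using prob_cells(2)[OF I(3) E] by simp
      qed
      have "prob (ev (x i) \<inter> cev t) = prob (B i \<inter> cev t)"
        using x[OF i] B(1)[OF i] cev_events[OF KU t] by (intro finite_measure_eq_AE) auto
      also have "\<dots> = prob (ev (b i) \<inter> cev t)"
        using B(3)[OF i] by (simp add: sum B(1)[OF i] biU[OF i])
      finally show "prob (ev (x i) \<inter> cev t) = prob (ev (b i) \<inter> cev t)" .
    next
      fix i j assume ij: "i < n" "j < n" "i \<noteq> j"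
      have "prob (ev (x i) \<inter> ev (x j)) = prob (B i \<inter> B j)"
      proof (rule finite_measure_eq_AE)
        show "AE z in M. z \<in> ev (x i) \<inter> ev (x j) \<longleftrightarrow> z \<in> B i \<inter> B j"
          using x(2)[OF ij(1)] x(2)[OF ij(2)] by eventually_elim auto
      qed (use ij B(1) x(1) in auto)
      then show "prob (ev (x i) \<inter> ev (x j)) = 0"
        using B(2) ij by (auto simp: disjoint_family_on_def)
    next
      fix i assume i: "i < n"
      have "pdist U (a i) (x i) = prob (sym_diff (A i) (B i))"
        unfolding pdist_ev[OF aiU[OF i] x(1)[OF i]]
      proof (rule finite_measure_eq_AE)
        show "AE z in M. z \<in> sym_diff (ev (a i)) (ev (x i)) \<longleftrightarrow> z \<in> sym_diff (A i) (B i)"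
          using A(2)[OF i] x(2)[OF i] by eventually_elim auto
      qed (use i A(1) B(1) aiU x(1) in auto)
      also have "\<dots> \<le> (\<Sum>J\<in>Pow I. \<bar>prob (ev (a i) \<inter> cell I v J) - prob (ev (b i) \<inter> cell I v J)\<bar>)"
        using B(4)[OF i] probA[OF i cell_events[OF I(3)]] by simp
      \<comment> \<open>The cells of \<open>K\<close> belong to the sigma-algebra of the full
        \<open>C\<close>, so the bound is uniform in \<open>K\<close>.\<close>
      also have "\<dots> \<le> cond_dist C (a i) (b i)"
        using I(1) cell_cond_sigma[OF C I(2,1)]
        by (intro cells_le_cond_dist[OF C aiU[OF i] biU[OF i]] disjoint_cells Un_cells) auto
      finally show "pdist U (a i) (x i) \<le> cond_dist C (a i) (b i)" .
    qed
  qed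
  then show ?thesis by (rule that)
qed

text \<open>Saturation provides one tuple for all finite parts of \<open>C\<close>. Its distances to
  \<open>a\<close> are bounded above by the type and below by \<open>cond_dist_le_pdist\<close>,
  hence they are equal to the conditional distances.\<close>

lemma transport:
  assumes C: "C \<subseteq> pcarrier U" and small: "|C| <o \<kappa>"
    and a: "partition_of_one U n a" and b: "partition_of_one U n b"
  obtains x where "partition_of_one U n x" "tp U n C x = tp U n C b"
    "\<And>i. i < n \<Longrightarrow> pdist U (a i) (x i) = cond_dist C (a i) (b i)"
proof -
  have aU: "a \<in> {..<n} \<rightarrow> pcarrier U" and bU: "b \<in> {..<n} \<rightarrow> pcarrier U"
    using a b by (simp_all add: partition_of_one_def)
  define \<Gamma> where "\<Gamma> = transport_type C (\<lambda>i. cond_dist C (a i) (b i)) n a b"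
  define P where "P = C \<union> a ` {..<n}"
  have "P \<subseteq> pcarrier U" using C aU by (auto simp: P_def)
  moreover have "|P| <o \<kappa>"
    unfolding P_def by (intro small_Un small small_finite) auto
  moreover have "\<Gamma> \<subseteq> formulas P n"
    unfolding \<Gamma>_def P_def by (intro transport_type_formulas) (simp add: L1_norm_def)
  moreover have "\<exists>x. realizes U n x \<Gamma>\<^sub>0" if \<Gamma>\<^sub>0: "\<Gamma>\<^sub>0 \<subseteq> \<Gamma>" "finite \<Gamma>\<^sub>0" for \<Gamma>\<^sub>0
  proof -
    obtain K where K: "finite K" "K \<subseteq> C"
      "\<Gamma>\<^sub>0 \<subseteq> transport_type K (\<lambda>i. cond_dist C (a i) (b i)) n a b"
      by (rule finite_subset_transport_type[OF \<Gamma>\<^sub>0(1)[unfolded \<Gamma>_def] \<Gamma>\<^sub>0(2)])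
    obtain x where "realizes U n x (transport_type K (\<lambda>i. cond_dist C (a i) (b i)) n a b)"
      by (rule transport_finite[OF C K(1,2) a b])
    then have "realizes U n x \<Gamma>\<^sub>0" using K(3) by (auto simp: realizes_def)
    then show ?thesis by blast
  qed
  ultimately have "\<exists>x. realizes U n x \<Gamma>"
    by (intro saturated[unfolded saturated_def, THEN spec[of _ P], THEN spec[of _ n],
          THEN spec[of _ \<Gamma>], THEN mp]) blast
  then obtain x where x: "realizes U n x \<Gamma>" ..
  then have xU: "x \<in> {..<n} \<rightarrow> pcarrier U" by (simp add: realizes_def)
  note real = x[unfolded \<Gamma>_def realizes_transport_type[OF C aU xU]]
  have eq: "prob (ev (x i) \<inter> cev t) = prob (ev (b i) \<inter> cev t)" if "i < n" "t \<in> closed_terms C" for i t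
    using real that by blast
  \<comment> \<open>The condition for the term \<open>TOne\<close> gives \<open>x i\<close> the
    measure of \<open>b i\<close>, and these measures add up to 1.\<close>
  have "(\<Sum>i<n. prob (ev (x i))) = 1"
  proof -
    have one: "prob (ev u \<inter> cev TOne) = prob (ev u)" if "u \<in> pcarrier U" for u
      using ev_one that cev_events[OF C closed_terms_intros(3)]
      by (intro finite_measure_eq_AE) (auto simp: cev_def)
    have "(\<Sum>i<n. prob (ev (x i))) = (\<Sum>i<n. prob (ev (b i) \<inter> space M))"
    proof (rule sum.cong[OF refl])
      fix i assume "i \<in> {..<n}"
      then have i: "i < n" "x i \<in> pcarrier U" "b i \<in> pcarrier U" using xU bU by auto
      then show "prob (ev (x i)) = prob (ev (b i) \<inter> space M)"
        using eq[OF i(1) closed_terms_intros(3)] one by simp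
    qed
    also have "\<dots> = 1" using sum_prob_partition[OF b sets.top] by (simp add: prob_space)
    finally show ?thesis .
  qed
  then have part: "partition_of_one U n x"
    using real by (intro partition_of_oneI[OF xU]) auto
  show ?thesis
  proof (rule that[OF part])
    show "tp U n C x = tp U n C b" by (rule tp_eq_partition[OF C part b eq])
    fix i assume i: "i < n"
    have "cond_dist C (a i) (b i) \<le> pdist U (a i) (x i)"
      using aU bU xU i eq[OF i] by (intro cond_dist_le_pdist[OF C]) auto
    then show "pdist U (a i) (x i) = cond_dist C (a i) (b i)"
      using real i by (auto intro: antisym)
  qed
qed

text \<open>The infimum is a minimum: it is attained at \<open>a\<close> together with the partition
  from \<open>transport\<close>, and every other pair of realizations obeys the lower bound in each
  coordinate.\<close>

lemma type_dist_eq: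
  assumes C: "C \<subseteq> pcarrier U" and small: "|C| <o \<kappa>"
    and a: "partition_of_one U n a" and b: "partition_of_one U n b"
  shows "type_dist U n (tp U n C a) (tp U n C b) = (MAX i\<in>{..<n}. cond_dist C (a i) (b i))"
proof -
  have aU: "a \<in> {..<n} \<rightarrow> pcarrier U" and bU: "b \<in> {..<n} \<rightarrow> pcarrier U"
    using a b by (simp_all add: partition_of_one_def)
  \<comment> \<open>An empty partition would give the space measure 0. Nonemptiness of the index set
    is needed for the maximum.\<close>
  have "n \<noteq> 0"
  proof
    assume "n = 0"
    then show False using sum_prob_partition[OF a sets.top] by (simp add: prob_space)
  qed
  then have ne: "{..<n} \<noteq> {}" by (simp add: lessThan_empty_iff)
  obtain x where x: "partition_of_one U n x" "tp U n C x = tp U n C b"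
    "\<And>i. i < n \<Longrightarrow> pdist U (a i) (x i) = cond_dist C (a i) (b i)"
    using transport[OF C small a b] by blast
  have "realizes U n a (tp U n C a)" using aU by (simp add: realizes_def tp_def)
  moreover have "realizes U n x (tp U n C b)"
    using x(1) unfolding x(2)[symmetric] by (simp add: realizes_def tp_def partition_of_one_def)
  moreover have "(MAX i\<in>{..<n}. cond_dist C (a i) (b i)) = (MAX i\<in>{..<n}. pdist U (a i) (x i))"
    using x(3) by (intro arg_cong[of _ _ Max] image_cong) auto
  ultimately show ?thesis
    unfolding type_dist_def
  proof (intro cInf_eq_minimum, goal_cases)
    case 1
    then show ?case by blast
  next
    case (2 d)
    then obtain a' b' where d: "d = (MAX i\<in>{..<n}. pdist U (a' i) (b' i))"
      and a': "realizes U n a' (tp U n C a)" and b': "realizes U n b' (tp U n C b)" by blast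
    have "cond_dist C (a i) (b i) \<le> d" if i: "i < n" for i
    proof -
      have "cond_dist C (a i) (b i) \<le> pdist U (a' i) (b' i)"
        using aU bU a' b' i realizes_tp_prob[OF C aU a' i] realizes_tp_prob[OF C bU b' i]
        by (intro cond_dist_le_pdist[OF C]) (auto simp: realizes_def)
      also have "\<dots> \<le> d" unfolding d using i by (intro Max_ge) auto
      finally show ?thesis .
    qed
    then show ?case using ne by (subst Max_le_iff) auto
  qed
qed

end

theorem theorem6p11:
  fixes U :: "'a pr_struct" and \<kappa> :: "'k rel" and C :: "'a set"
    and M :: "'x measure" and h :: "'a \<Rightarrow> 'x set set"
    and n :: nat and a b :: "nat \<Rightarrow> 'a"
  assumes "Card_order \<kappa>" and "natLeq <o \<kappa>"
    and "universal_domain \<kappa> APA U"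
    and "prob_space M" and "pr_iso U (prob_algebra_of M) h"
    and "C \<subseteq> pcarrier U" and "|C| <o \<kappa>"
    and "partition_of_one U n a" and "partition_of_one U n b"
  shows "type_dist U n (tp U n C a) (tp U n C b) =
           (MAX i\<in>{..<n}. L1_norm M (\<lambda>x. cprob M h (gen U C) (a i) x - cprob M h (gen U C) (b i) x)) \<and>
         (\<exists>b'. partition_of_one U n b' \<and> tp U n C b' = tp U n C b \<and>
           (\<forall>i<n. pdist U (a i) (b' i) =
              L1_norm M (\<lambda>x. cprob M h (gen U C) (a i) x - cprob M h (gen U C) (b i) x)))"
proof -
  interpret prob_space M by fact
  interpret apa_domain M U h \<kappa>
    using assms(1-5) by unfold_locales (auto simp: universal_domain_def models_def)
  show ?thesis
    using type_dist_eq[OF assms(6-9)] transport[OF assms(6-9)] by metis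
qed

end
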